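(* For every $f\in A^2_1$, we have $$\lim_{N\to\infty}\operatorname{dist}_{A^2_1}(f,\mathcal{SF}_N)=\frac{\pi}{\sqrt3}.$$
   Context: $\mathbb D$ is the open unit disk of $\mathbb C$, $\mathbb T$ is the unit circle, and $m_2$ is normalized planar Lebesgue measure, $dm_2(z)=\pi^{-1}\,dx\,dy$. $A^2_1$ is the space of all $f$ holomorphic in $\mathbb D$ with $\|f\|_1^2=2\int_{\mathbb D}|f(z)|^2(1-|z|^2)\,dm_2(z)<\infty$. For $N\ge1$, $$\mathcal{SF}_N=\Bigl\{\sum_{0\le j<N}\frac1{z-z_{j}}: z_{j}\in\mathbb T,\ 0\le j<N\Bigr\}$$ (the points $z_j$ need not be distinct), and $\operatorname{dist}_{A^2_1}(f,\mathcal{SF}_N)=\inf_{h\in\mathcal{SF}_N}\|f-h\|_1$. *)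

theory Defs
  imports "HOL-Complex_Analysis.Complex_Analysis"
begin

abbreviation unit_disk :: "complex set" where
  "unit_disk \<equiv> ball 0 1"

abbreviation unit_circle :: "complex set" where
  "unit_circle \<equiv> sphere 0 1"

definition m2 :: "complex measure" where
  "m2 = scale_measure (ennreal (1 / pi)) lborel"

text \<open>
  Elements of the weighted Bergman space are represented by total functions on the complex
  plane; values outside the open unit disk are irrelevant.
\<close>

definition bergman1 :: "(complex \<Rightarrow> complex) set" where
  "bergman1 = {f. f holomorphic_on unit_disk \<and>
     set_integrable m2 unit_disk (\<lambda>z. (cmod (f z))\<^sup>2 * (1 - (cmod z)\<^sup>2))}"

text \<open>
  The integral below is a Bochner integral, hence 0 for non-integrable arguments, so this is
  the norm only on \<^const>\<open>bergman1\<close>.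
\<close>

definition bergman1_norm :: "(complex \<Rightarrow> complex) \<Rightarrow> real" where
  "bergman1_norm f =
     sqrt (2 * (LINT z:unit_disk|m2. (cmod (f z))\<^sup>2 * (1 - (cmod z)\<^sup>2)))"

definition SF :: "nat \<Rightarrow> (complex \<Rightarrow> complex) set" where
  "SF N = {(\<lambda>z. \<Sum>j<N. 1 / (z - w j)) | w. \<forall>j<N. w j \<in> unit_circle}"

text \<open>
  Used only for \<open>f\<close> in \<^const>\<open>bergman1\<close> and \<open>S = SF N\<close>. Since
  \<open>1 - |z|\<^sup>2 \<le> 2 |z - w|\<close> for \<open>|z| < 1\<close> and \<open>|w| = 1\<close>, the set \<open>SF N\<close> is contained in
  \<^const>\<open>bergman1\<close>, so every difference \<open>f - h\<close> lies in the space; moreover \<open>SF N\<close> is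
  nonempty, so the infimum is taken over a nonempty set of reals bounded below by 0.
\<close>

definition bergman1_dist :: "(complex \<Rightarrow> complex) \<Rightarrow> (complex \<Rightarrow> complex) set \<Rightarrow> real" where
  "bergman1_dist f S = (INF h\<in>S. bergman1_norm (\<lambda>z. f z - h z))"

end

theory Submission
  imports Defs "HOL-Computational_Algebra.Fundamental_Theorem_Algebra"
begin

text \<open>
  On Taylor coefficients the squared norm is \<open>\<Sum> 2 |a\<^sub>n|\<^sup>2 / ((n + 1) (n + 2))\<close>, and for
  \<open>h = \<Sum>\<^sub>j 1 / (z - z\<^sub>j)\<close> the coefficients are \<open>- q\<^bsub>n+1\<^esub>\<close> with \<open>q\<^sub>k\<close> the power sums of the conjugate
  poles. By the triangle inequality and density it suffices to treat a polynomial \<open>f\<close>.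

  Upper bound. Approximate \<open>f\<close> by \<open>Q' / Q\<close> with \<open>Q\<close> a polynomial without zeros in the closed disk. With
  \<open>q\<close> the conjugate reciprocal polynomial of \<open>Q\<close>, all \<open>N\<close> zeros of \<open>P = Q - z\<^sup>m q\<close> lie on the circle, and
  \<open>P' / P = Q' / Q - B' / (1 - B)\<close> for the Blaschke product \<open>B = z\<^sup>m q / Q\<close>. Here \<open>B' / (1 - B)\<close> is the
  derivative of \<open>\<Sum> B\<^sup>k / k\<close>, whose Hardy norm squared is \<open>\<Sum> 1 / k\<^sup>2 = \<pi>\<^sup>2 / 6\<close> as the powers of \<open>B\<close> are
  orthonormal; the squared weighted norm of a derivative is at most twice the squared Hardy norm.

  Lower bound. If \<open>h\<close> is close to \<open>f\<close>, the power sums \<open>q\<^sub>k\<close> with \<open>k \<le> K\<close> are bounded independently of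
  \<open>N\<close>. Let \<open>V\<close> be the logarithm \<open>\<Sum>\<^sub>j Ln (1 - z cnj z\<^sub>j)\<close> without its Taylor polynomial \<open>T\<close> of degree \<open>K\<close>.
  On the circle \<open>2 Im V\<close> agrees modulo \<open>2 \<pi>\<close> with \<open>N \<theta> + c - 2 Im T\<close>. Hence \<open>|Im V|\<close> is at least half the
  distance of this rapidly rotating phase from \<open>2 \<pi> \<int>\<close>, whose mean square tends to \<open>\<pi>\<^sup>2 / 12\<close>, while
  the mean square of \<open>Im V\<close> is \<open>1/2 \<Sum>\<^bsub>k>K\<^esub> |q\<^sub>k|\<^sup>2 / k\<^sup>2\<close>.
\<close>

subsection \<open>Fourier analysis on the circle\<close>

text \<open>The parameter is the fraction of a full turn, so that the mean over the circle is the
  plain integral over \<open>{0..1}\<close>.\<close>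

definition circ :: "real \<Rightarrow> complex" where "circ t = cis (2 * pi * t)"

lemma norm_circ [simp]: "norm (circ t) = 1"
  by (simp add: circ_def)

lemma continuous_on_circ [continuous_intros]:
  "continuous_on A g \<Longrightarrow> continuous_on A (\<lambda>x. circ (g x))"
  unfolding circ_def by (intro continuous_intros)

lemma circ_power: "circ t ^ n = cis (2 * pi * real n * t)"
  by (simp only: circ_def Complex.DeMoivre) (simp add: mult_ac)

lemma circ_has_vector_derivative:
  "((\<lambda>t. circ (a * t)) has_vector_derivative (2 * pi * a) *\<^sub>R (\<i> * circ (a * t))) (at t within S)"
proof -
  have "((\<lambda>z. exp (\<i> * of_real (2 * pi * a) * z)) has_field_derivative
      \<i> * of_real (2 * pi * a) * exp (\<i> * of_real (2 * pi * a) * of_real t)) (at (of_real t))"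
    by (auto intro!: derivative_eq_intros)
  from has_vector_derivative_real_field[OF this] show ?thesis
    unfolding circ_def cis_conv_exp by (simp add: scaleR_conv_of_real mult_ac)
qed

lemma has_integral_circ_int:
  fixes k :: int
  shows "((\<lambda>t. circ (of_int k * t)) has_integral (if k = 0 then 1 else 0)) {0..1}"
proof (cases "k = 0")
  case True
  then show ?thesis
    using has_integral_const_real[of "1::complex" 0 1] by (simp add: circ_def)
next
  case False
  let ?c = "1 / (2 * pi * \<i> * of_int k) :: complex"
  have "((\<lambda>t. circ (of_int k * t)) has_integral ?c * circ (of_int k * 1) - ?c * circ (of_int k * 0)) {0..1}"
  proof (rule fundamental_theorem_of_calculus)
    fix t :: real
    have "((\<lambda>t. ?c * circ (of_int k * t)) has_vector_derivative
        ?c * ((2 * pi * of_int k) *\<^sub>R (\<i> * circ (of_int k * t)))) (at t within {0..1})"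
      by (intro has_vector_derivative_mult_right circ_has_vector_derivative)
    moreover have "?c * ((2 * pi * of_int k) *\<^sub>R (\<i> * circ (of_int k * t))) = circ (of_int k * t)"
      using False by (simp add: scaleR_conv_of_real field_simps)
    ultimately show "((\<lambda>t. ?c * circ (of_int k * t)) has_vector_derivative circ (of_int k * t)) (at t within {0..1})"
      by simp
  qed auto
  moreover have "circ (of_int k * 1) = 1" "circ (of_int k * 0) = 1"
    by (simp_all add: circ_def cis_multiple_2pi)
  ultimately show ?thesis using False by simp
qed

text \<open>The majorant makes the convergence uniform, so integration is termwise. Summability of
  the integrals comes out of the same limit.\<close>

lemma has_integral_suminf:
  fixes f :: "nat \<Rightarrow> real \<Rightarrow> complex"
  assumes f: "\<And>n. continuous_on {a..b} (f n)" "\<And>n. (f n has_integral I n) {a..b}"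
    and M: "\<And>n t. t \<in> {a..b} \<Longrightarrow> norm (f n t) \<le> M n" "summable M"
  shows "((\<lambda>t. \<Sum>n. f n t) has_integral (\<Sum>n. I n)) {a..b}" "summable I"
proof -
  have u: "uniform_limit {a..b} (\<lambda>n t. \<Sum>i<n. f i t) (\<lambda>t. \<Sum>i. f i t) sequentially"
    by (rule Weierstrass_m_test) (use M in auto)
  obtain J K where J: "\<And>n. ((\<lambda>t. \<Sum>i<n. f i t) has_integral J n) {a..b}"
    and K: "((\<lambda>t. \<Sum>i. f i t) has_integral K) {a..b}" and lim: "J \<longlonglongrightarrow> K"
    by (rule uniform_limit_integral[OF u]) (use f in \<open>auto intro!: continuous_intros\<close>)
  have "J = (\<lambda>n. \<Sum>i<n. I i)"
    by (rule ext, rule has_integral_unique[OF J]) (intro has_integral_sum f finite_lessThan)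
  with lim have "I sums K" by (simp add: sums_def)
  with K show "((\<lambda>t. \<Sum>n. f n t) has_integral (\<Sum>n. I n)) {a..b}" "summable I"
    by (simp_all add: sums_iff)
qed

text \<open>Absolute summability is the natural setting here: the series that occur are Taylor
  series on a circle strictly inside the disk of convergence.\<close>

lemma fourier_coefficient:
  fixes c :: "nat \<Rightarrow> complex"
  assumes "summable (\<lambda>n. norm (c n))"
  shows "((\<lambda>t. (\<Sum>n. c n * circ t ^ n) * cnj (circ t ^ m)) has_integral c m) {0..1}"
proof -
  have s: "summable (\<lambda>n. c n * circ t ^ n)" for t
    by (rule summable_norm_cancel) (use assms in \<open>simp add: norm_mult norm_power\<close>)
  have eq: "circ t ^ n * cnj (circ t ^ m) = circ (of_int (int n - int m) * t)" for n t
    by (simp add: circ_power cis_cnj cis_mult) (simp add: circ_def algebra_simps)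
  have "((\<lambda>t. \<Sum>n. c n * (circ t ^ n * cnj (circ t ^ m))) has_integral
      (\<Sum>n. c n * (if int n - int m = 0 then 1 else 0))) {0..1}"
  proof (rule has_integral_suminf(1))
    show "((\<lambda>t. c n * (circ t ^ n * cnj (circ t ^ m))) has_integral
        c n * (if int n - int m = 0 then 1 else 0)) {0..1}" for n
      unfolding eq by (intro has_integral_mult_right has_integral_circ_int)
    show "norm (c n * (circ t ^ n * cnj (circ t ^ m))) \<le> norm (c n)" for n t
      by (simp add: norm_mult norm_power)
  qed (use assms in \<open>auto intro!: continuous_intros\<close>)
  moreover have "(\<Sum>n. c n * (if int n - int m = 0 then 1 else 0)) = c m"
    by (subst suminf_finite[of "{m}"]) auto
  moreover have "(\<Sum>n. c n * (circ t ^ n * cnj (circ t ^ m))) = (\<Sum>n. c n * circ t ^ n) * cnj (circ t ^ m)" for t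
    using suminf_mult2[OF s] by (simp add: mult.assoc)
  ultimately show ?thesis by simp
qed

text \<open>One of the two factors of the squared modulus is expanded as a conjugate series; each
  resulting term is a Fourier coefficient of the other factor.\<close>

lemma parseval:
  fixes c :: "nat \<Rightarrow> complex"
  assumes c: "summable (\<lambda>n. norm (c n))"
  shows "((\<lambda>t. (norm (\<Sum>n. c n * circ t ^ n))\<^sup>2) has_integral (\<Sum>n. (norm (c n))\<^sup>2)) {0..1}"
    "summable (\<lambda>n. (norm (c n))\<^sup>2)"
proof -
  define G where "G t = (\<Sum>n. c n * circ t ^ n)" for t
  define B where "B = (\<Sum>n. norm (c n))"
  have s: "summable (\<lambda>n. norm (c n * circ t ^ n))" for t
    using c by (simp add: norm_mult norm_power)
  have GB: "norm (G t) \<le> B" for t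
    unfolding G_def B_def using summable_norm[OF s] by (simp add: norm_mult norm_power)
  have contG: "continuous_on {0..1} G"
    unfolding G_def
    by (rule uniform_limit_theorem[OF _ Weierstrass_m_test[where M="\<lambda>n. norm (c n)"]])
       (use c in \<open>auto intro!: always_eventually continuous_intros simp: norm_mult norm_power\<close>)
  have *: "((\<lambda>t. \<Sum>m. cnj (c m) * (G t * cnj (circ t ^ m))) has_integral (\<Sum>m. cnj (c m) * c m)) {0..1}"
    "summable (\<lambda>m. cnj (c m) * c m)"
  proof -
    have 1: "continuous_on {0..1} (\<lambda>t. cnj (c m) * (G t * cnj (circ t ^ m)))" for m
      by (intro continuous_intros contG)
    have 2: "((\<lambda>t. cnj (c m) * (G t * cnj (circ t ^ m))) has_integral cnj (c m) * c m) {0..1}" for m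
      unfolding G_def by (intro has_integral_mult_right fourier_coefficient c)
    have 3: "norm (cnj (c m) * (G t * cnj (circ t ^ m))) \<le> norm (c m) * B" for m t
      using GB by (simp add: norm_mult norm_power mult_left_mono)
    show "((\<lambda>t. \<Sum>m. cnj (c m) * (G t * cnj (circ t ^ m))) has_integral (\<Sum>m. cnj (c m) * c m)) {0..1}"
      "summable (\<lambda>m. cnj (c m) * c m)"
      using has_integral_suminf[OF 1 2 3 summable_mult2[OF c]] by auto
  qed
  have sq: "cnj x * x = of_real ((norm x)\<^sup>2)" for x
    by (metis complex_norm_square mult.commute)
  have "(\<Sum>m. cnj (c m) * (G t * cnj (circ t ^ m))) = of_real ((norm (G t))\<^sup>2)" for t
  proof -
    have "(\<lambda>m. c m * circ t ^ m) sums G t"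
      unfolding G_def by (rule summable_sums, rule summable_norm_cancel, rule s)
    then have "(\<lambda>m. G t * cnj (c m * circ t ^ m)) sums (G t * cnj (G t))"
      using sums_cnj sums_mult by blast
    then show ?thesis by (simp add: sums_iff mult_ac) (simp add: complex_norm_square [symmetric])
  qed
  then have "((\<lambda>t. complex_of_real ((norm (G t))\<^sup>2)) has_integral (\<Sum>m. of_real ((norm (c m))\<^sup>2))) {0..1}"
    using *(1) unfolding sq by simp
  moreover show su: "summable (\<lambda>n. (norm (c n))\<^sup>2)"
    using *(2) unfolding sq summable_of_real_iff .
  ultimately have "((\<lambda>t. complex_of_real ((norm (G t))\<^sup>2)) has_integral of_real (\<Sum>m. (norm (c m))\<^sup>2)) {0..1}"
    by (simp only: suminf_of_real)
  from has_integral_Re[OF this] show "((\<lambda>t. (norm (\<Sum>n. c n * circ t ^ n))\<^sup>2) has_integral (\<Sum>n. (norm (c n))\<^sup>2)) {0..1}"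
    by (simp add: G_def)
qed

text \<open>Convergence at a real radius strictly between \<open>norm w\<close> and \<open>R\<close>
  gives a geometric majorant at \<open>w\<close>.\<close>

lemma power_series_abs_summable:
  fixes a :: "nat \<Rightarrow> complex"
  assumes "\<And>z. z \<in> ball 0 R \<Longrightarrow> (\<lambda>n. a n * z ^ n) sums g z" "norm w < R"
  shows "summable (\<lambda>n. norm (a n * w ^ n))"
proof -
  obtain r where r: "norm w < r" "r < R" using dense[OF assms(2)] by blast
  have "summable (\<lambda>n. a n * of_real r ^ n)"
    using assms(1)[of "of_real r"] r norm_ge_zero[of w] by (auto simp: sums_iff)
  from powser_insidea[OF this, of w] r norm_ge_zero[of w] show ?thesis by auto
qed

text \<open>The mean is the Fourier coefficient of index 0; \<open>R > 1\<close> makes the Taylor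
  series absolutely convergent on the unit circle.\<close>

lemma mean_value_circle:
  assumes g: "g holomorphic_on ball 0 R" and R: "R > 1"
  shows "((\<lambda>t. g (circ t)) has_integral g 0) {0..1}"
proof -
  define a where "a n = (deriv ^^ n) g 0 / fact n" for n
  have a: "(\<lambda>n. a n * z ^ n) sums g z" if "z \<in> ball 0 R" for z
    using holomorphic_power_series[OF g that] by (simp add: a_def)
  have "summable (\<lambda>n. norm (a n))"
    using power_series_abs_summable[OF a, of R 1] R by simp
  from fourier_coefficient[OF this, of 0]
  have "((\<lambda>t. \<Sum>n. a n * circ t ^ n) has_integral a 0) {0..1}" by simp
  moreover have "(\<Sum>n. a n * circ t ^ n) = g (circ t)" for t
    using a[of "circ t"] R by (simp add: sums_iff)
  moreover have "a 0 = g 0" by (simp add: a_def)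
  ultimately show ?thesis by simp
qed

subsection \<open>Integration over the disk\<close>

lemma measurable_Complex [measurable]:
  "(\<lambda>(x, y). Complex x y) \<in> borel_measurable (borel \<Otimes>\<^sub>M borel)"
  unfolding borel_prod complex_eq[abs_def] case_prod_beta
  by (intro borel_measurable_continuous_onI continuous_intros)

text \<open>Lebesgue measure is determined by its values on boxes, and the preimage of a box is a
  product of two intervals.\<close>

lemma lborel_complex:
  "(lborel :: complex measure) = distr (lborel \<Otimes>\<^sub>M lborel) borel (\<lambda>(x, y). Complex x y)"
proof (rule lborel_eqI)
  fix l u :: complex
  assume b: "\<And>b. b \<in> Basis \<Longrightarrow> l \<bullet> b \<le> u \<bullet> b"
  have le: "Re l \<le> Re u" "Im l \<le> Im u"
    using b[of 1] b[of \<i>] by (auto simp: Basis_complex_def inner_complex_def)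
  have m: "(\<lambda>(x, y). Complex x y) \<in> measurable (lborel \<Otimes>\<^sub>M lborel) borel"
    using measurable_Complex by (simp cong: measurable_cong_sets)
  have v: "(\<lambda>(x, y). Complex x y) -` box l u = {Re l<..<Re u} \<times> {Im l<..<Im u}"
    by (auto simp: in_box_complex_iff)
  have "emeasure (distr (lborel \<Otimes>\<^sub>M lborel) borel (\<lambda>(x, y). Complex x y)) (box l u)
      = emeasure (lborel \<Otimes>\<^sub>M lborel) ({Re l<..<Re u} \<times> {Im l<..<Im u})"
    by (subst emeasure_distr[OF m]) (simp_all add: v space_pair_measure)
  also have "\<dots> = ennreal (Re u - Re l) * ennreal (Im u - Im l)"
    by (subst lborel.emeasure_pair_measure_Times) (use le in auto)
  finally show "emeasure (distr (lborel \<Otimes>\<^sub>M lborel) borel (\<lambda>(x, y). Complex x y)) (box l u)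
      = ennreal (\<Prod>b\<in>Basis. (u - l) \<bullet> b)"
    using le by (simp add: Basis_complex_def inner_complex_def ennreal_mult)
qed simp

lemma nn_integral_complex:
  assumes [measurable]: "f \<in> borel_measurable (borel :: complex measure)"
  shows "(\<integral>\<^sup>+z. f z \<partial>lborel) = (\<integral>\<^sup>+x. \<integral>\<^sup>+y. f (Complex x y) \<partial>lborel \<partial>lborel)"
    and "(\<integral>\<^sup>+z. f z \<partial>lborel) = (\<integral>\<^sup>+y. \<integral>\<^sup>+x. f (Complex x y) \<partial>lborel \<partial>lborel)"
proof -
  have m [measurable]: "(\<lambda>(x, y). Complex x y) \<in> measurable (lborel \<Otimes>\<^sub>M lborel) borel"
    using measurable_Complex by (simp cong: measurable_cong_sets)
  have 1: "(\<integral>\<^sup>+z. f z \<partial>lborel) = (\<integral>\<^sup>+p. f (case p of (x, y) \<Rightarrow> Complex x y) \<partial>(lborel \<Otimes>\<^sub>M lborel))"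
    by (subst lborel_complex, subst nn_integral_distr) auto
  have 2: "(\<lambda>p. f (case p of (x, y) \<Rightarrow> Complex x y)) \<in> borel_measurable (lborel \<Otimes>\<^sub>M lborel)"
    by (rule measurable_compose[OF m]) simp
  show "(\<integral>\<^sup>+z. f z \<partial>lborel) = (\<integral>\<^sup>+x. \<integral>\<^sup>+y. f (Complex x y) \<partial>lborel \<partial>lborel)"
    unfolding 1 by (subst lborel.nn_integral_fst[OF 2, symmetric]) simp
  show "(\<integral>\<^sup>+z. f z \<partial>lborel) = (\<integral>\<^sup>+y. \<integral>\<^sup>+x. f (Complex x y) \<partial>lborel \<partial>lborel)"
    unfolding 1 by (subst lborel_pair.nn_integral_snd[OF 2, symmetric]) simp
qed

text \<open>For a fixed imaginary part the shear is a translation of the real line.\<close>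

lemma nn_integral_shear_Re:
  assumes [measurable]: "f \<in> borel_measurable (borel :: complex measure)"
  shows "(\<integral>\<^sup>+z. f (Complex (Re z + a * Im z) (Im z)) \<partial>lborel) = (\<integral>\<^sup>+z. f z \<partial>lborel)"
proof -
  have [measurable]: "(\<lambda>z. Complex (Re z + a * Im z) (Im z)) \<in> borel_measurable borel"
    "\<And>y. (\<lambda>x. Complex x y) \<in> borel_measurable borel"
    unfolding complex_eq by (intro borel_measurable_continuous_onI continuous_intros)+
  have "(\<integral>\<^sup>+x. f (Complex x y) \<partial>lborel) = (\<integral>\<^sup>+x. f (Complex (x + a * y) y) \<partial>lborel)" for y
    using nn_integral_real_affine[of "\<lambda>x. f (Complex x y)" 1 "a * y"] by (simp add: add.commute)
  then show ?thesis
    by (subst (1 2) nn_integral_complex(2)) (simp_all add: measurable_compose[of _ borel borel f])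
qed

lemma nn_integral_shear_Im:
  assumes [measurable]: "f \<in> borel_measurable (borel :: complex measure)"
  shows "(\<integral>\<^sup>+z. f (Complex (Re z) (Im z + a * Re z)) \<partial>lborel) = (\<integral>\<^sup>+z. f z \<partial>lborel)"
proof -
  have [measurable]: "(\<lambda>z. Complex (Re z) (Im z + a * Re z)) \<in> borel_measurable borel"
    "\<And>x. (\<lambda>y. Complex x y) \<in> borel_measurable borel"
    unfolding complex_eq by (intro borel_measurable_continuous_onI continuous_intros)+
  have "(\<integral>\<^sup>+y. f (Complex x y) \<partial>lborel) = (\<integral>\<^sup>+y. f (Complex x (y + a * x)) \<partial>lborel)" for x
    using nn_integral_real_affine[of "\<lambda>y. f (Complex x y)" 1 "a * x"] by (simp add: add.commute)
  then show ?thesis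
    by (subst (1 2) nn_integral_complex(1)) (simp_all add: measurable_compose[of _ borel borel f])
qed

text \<open>A rotation is a product of three shears, each of which preserves the measure.\<close>

lemma nn_integral_rotate:
  assumes f: "f \<in> borel_measurable (borel :: complex measure)" and u: "norm u = 1"
  shows "(\<integral>\<^sup>+z. f (u * z) \<partial>lborel) = (\<integral>\<^sup>+z. f z \<partial>lborel)"
proof -
  have *: "(\<integral>\<^sup>+z. f (u * z) \<partial>lborel) = (\<integral>\<^sup>+z. f z \<partial>lborel)"
    if f: "f \<in> borel_measurable (borel :: complex measure)" and u: "norm u = 1" "u \<noteq> -1" for f u
  proof -
    \<comment> \<open>\<open>a\<close> is minus the tangent of half the rotation angle and
      \<open>Im u\<close> is the sine of the angle; the tangent is undefined only for the half turn
      u = -1.\<close>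
    define a where "a = - Im u / (1 + Re u)"
    define X where "X z = Complex (Re z + a * Im z) (Im z)" for z
    define Y where "Y z = Complex (Re z) (Im z + Im u * Re z)" for z
    have [measurable]: "X \<in> borel_measurable borel" "Y \<in> borel_measurable borel"
      unfolding X_def[abs_def] Y_def[abs_def] complex_eq
      by (intro borel_measurable_continuous_onI continuous_intros)+
    note [measurable] = f
    have sq: "(Re u)\<^sup>2 + (Im u)\<^sup>2 = 1" using u(1) by (simp add: cmod_def)
    have "1 + Re u \<noteq> 0"
    proof
      assume "1 + Re u = 0"
      then have "Re u = -1" by simp
      with sq have "Im u = 0" by simp
      with \<open>Re u = -1\<close> show False using u(2) by (simp add: complex_eq_iff)
    qed
    then have ac: "a * (1 + Re u) = - Im u" by (simp add: a_def)
    have as: "1 + a * Im u = Re u"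
    proof -
      have "(1 + Re u) * (1 + a * Im u) = 1 + Re u - (Im u)\<^sup>2"
        using arg_cong[OF ac, of "\<lambda>x. x * Im u"] by (simp add: algebra_simps power2_eq_square)
      also have "\<dots> = (1 + Re u) * Re u"
        using sq by (simp add: algebra_simps power2_eq_square)
      finally show ?thesis using \<open>1 + Re u \<noteq> 0\<close> by simp
    qed
    have "u * z = X (Y (X z))" for z
    proof -
      have "Re (X (Y (X z))) = (1 + a * Im u) * Re z + a * (1 + (1 + a * Im u)) * Im z"
        "Im (X (Y (X z))) = Im u * Re z + (1 + a * Im u) * Im z"
        by (simp_all add: X_def Y_def algebra_simps)
      then show ?thesis unfolding as ac by (simp add: complex_eq_iff)
    qed
    then have "(\<integral>\<^sup>+z. f (u * z) \<partial>lborel) = (\<integral>\<^sup>+z. f (X (Y (X z))) \<partial>lborel)" by simp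
    also have "\<dots> = (\<integral>\<^sup>+z. f (X (Y z)) \<partial>lborel)"
      using nn_integral_shear_Re[of "\<lambda>z. f (X (Y z))" a] by (simp add: X_def[symmetric])
    also have "\<dots> = (\<integral>\<^sup>+z. f (X z) \<partial>lborel)"
      using nn_integral_shear_Im[of "\<lambda>z. f (X z)" "Im u"] by (simp add: Y_def[symmetric])
    also have "\<dots> = (\<integral>\<^sup>+z. f z \<partial>lborel)"
      using nn_integral_shear_Re[of f a] by (simp add: X_def[symmetric])
    finally show ?thesis .
  qed
  show ?thesis
  proof (cases "u = -1")
    case False
    then show ?thesis using *[OF f u] by blast
  next
    case True
    \<comment> \<open>The half turn is a quarter turn performed twice.\<close>
    have i: "norm \<i> = 1" "\<i> \<noteq> -1" by (auto simp: complex_eq_iff)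
    have "(\<lambda>z. f (\<i> * z)) \<in> borel_measurable borel"
      by (intro measurable_compose[OF _ f] borel_measurable_continuous_onI continuous_intros)
    from *[OF this i] *[OF f i] True show ?thesis by (simp add: mult.assoc[symmetric])
  qed
qed

section \<open>Normalized area and radial integrals\<close>

lemma sets_m2 [simp, measurable_cong]: "sets m2 = sets borel"
  by (simp add: m2_def)

lemma space_m2 [simp]: "space m2 = UNIV"
  by (simp add: m2_def space_scale_measure)

lemma measurable_indicator_disk [measurable, simp]:
  "(indicator unit_disk :: complex \<Rightarrow> ennreal) \<in> borel_measurable m2"
  by (rule borel_measurable_indicator) simp

lemma nn_integral_m2:
  "f \<in> borel_measurable borel \<Longrightarrow> (\<integral>\<^sup>+z. f z \<partial>m2) = ennreal (1 / pi) * (\<integral>\<^sup>+z. f z \<partial>lborel)"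
  unfolding m2_def by (simp add: nn_integral_scale_measure)

lemma emeasure_m2_disk:
  assumes "0 \<le> r"
  shows "emeasure m2 (ball 0 r) = ennreal (r\<^sup>2)" "emeasure m2 (cball 0 r) = ennreal (r\<^sup>2)"
  using assms by (auto simp: m2_def emeasure_ball emeasure_cball unit_ball_vol_2 ennreal_mult'[symmetric])

text \<open>The disk of radius r has normalized area r^2, so the squared modulus is uniformly
  distributed on the unit interval. It suffices to compare the two finite measures on the rays
  \<open>{x<..}\<close>.\<close>

lemma distr_norm_squared:
  "distr (density m2 (indicator unit_disk)) borel (\<lambda>z. (norm z)\<^sup>2) = density lborel (indicator {0..1})"
    (is "?L = ?R")
proof (rule measure_eqI_lessThan)
  have L: "emeasure ?L {x<..} = emeasure m2 {z \<in> unit_disk. x < (norm z)\<^sup>2}" for x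
  proof -
    have "emeasure ?L {x<..} = emeasure (density m2 (indicator unit_disk)) {z. x < (norm z)\<^sup>2}"
      by (subst emeasure_distr) (auto simp: vimage_def)
    also have "\<dots> = (\<integral>\<^sup>+z. indicator {z \<in> unit_disk. x < (norm z)\<^sup>2} z \<partial>m2)"
      by (subst emeasure_density[OF measurable_indicator_disk], simp)
         (intro nn_integral_cong, auto split: split_indicator)
    also have "\<dots> = emeasure m2 {z \<in> unit_disk. x < (norm z)\<^sup>2}"
      by (rule nn_integral_indicator) simp
    finally show ?thesis .
  qed
  have R: "emeasure ?R {x<..} = emeasure lborel ({0..1} \<inter> {x<..})" for x
    by (subst emeasure_density) (simp_all add: indicator_inter_arith [symmetric])
  show "emeasure ?L {x<..} < \<infinity>" for x
  proof -
    have "emeasure m2 {z \<in> unit_disk. x < (norm z)\<^sup>2} \<le> emeasure m2 unit_disk"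
      by (intro emeasure_mono) auto
    also have "\<dots> < \<infinity>" using emeasure_m2_disk[of 1] by simp
    finally show ?thesis unfolding L .
  qed
  show "emeasure ?L {x<..} = emeasure ?R {x<..}" for x
  proof -
    consider "x < 0" | "0 \<le> x" "x \<le> 1" | "1 < x" by linarith
    then show ?thesis
    proof cases
      case 1
      have "x < (norm z)\<^sup>2" for z :: complex
        using 1 zero_le_power2[of "norm z"] by linarith
      with 1 have "{z \<in> unit_disk. x < (norm z)\<^sup>2} = unit_disk" "{0..1} \<inter> {x<..} = {0..1}"
        by auto
      then show ?thesis unfolding L R using emeasure_m2_disk[of 1] by simp
    next
      case 2
      have sq: "x < (norm z)\<^sup>2 \<longleftrightarrow> sqrt x < norm z" for z :: complex
        using real_sqrt_less_iff[of x "(norm z)\<^sup>2"] by simp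
      have "{z \<in> unit_disk. x < (norm z)\<^sup>2} = unit_disk - cball 0 (sqrt x)" "{0..1} \<inter> {x<..} = {x<..1}"
        unfolding sq using 2 by (auto simp: not_le)
      moreover have "emeasure m2 (unit_disk - cball 0 (sqrt x)) = ennreal (1 - x)" if "x < 1"
      proof -
        have sub: "cball 0 (sqrt x) \<subseteq> (unit_disk :: complex set)"
          using that by (simp add: cball_subset_ball_iff)
        have "emeasure m2 (unit_disk - cball 0 (sqrt x)) = emeasure m2 unit_disk - emeasure m2 (cball 0 (sqrt x))"
          by (rule emeasure_Diff[OF _ _ _ sub]) (use 2 emeasure_m2_disk(2)[of "sqrt x"] in simp_all)
        also have "\<dots> = ennreal (1 - x)"
          using 2 emeasure_m2_disk(1)[of 1] emeasure_m2_disk(2)[of "sqrt x"]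
          by (simp add: ennreal_minus[symmetric])
        finally show ?thesis .
      qed
      moreover have "emeasure m2 (unit_disk - cball 0 1) = 0"
      proof -
        have "unit_disk - cball 0 1 = ({} :: complex set)" by auto
        then show ?thesis by (simp only: emeasure_empty)
      qed
      ultimately show ?thesis unfolding L R using 2 by (cases "x = 1") auto
    next
      case 3
      then have "{0..1} \<inter> {x<..} = {}" by auto
      moreover have "\<not> x < (norm z)\<^sup>2" if "norm z < 1" for z :: complex
        using power_le_one[of "norm z" 2] that 3 by simp
      then have "{z \<in> unit_disk. x < (norm z)\<^sup>2} = {}" by auto
      ultimately show ?thesis unfolding L R by (simp only:) simp
    qed
  qed
qed auto

lemma nn_integral_radial:
  assumes [measurable]: "\<phi> \<in> borel_measurable borel"
  shows "(\<integral>\<^sup>+z\<in>unit_disk. \<phi> ((norm z)\<^sup>2) \<partial>m2) = (\<integral>\<^sup>+t\<in>{0..1}. \<phi> t \<partial>lborel)"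
proof -
  have "(\<integral>\<^sup>+z\<in>unit_disk. \<phi> ((norm z)\<^sup>2) \<partial>m2)
      = (\<integral>\<^sup>+z. \<phi> ((norm z)\<^sup>2) \<partial>density m2 (indicator unit_disk))"
    by (subst nn_integral_density) (auto simp: mult.commute)
  also have "\<dots> = (\<integral>\<^sup>+t. \<phi> t \<partial>density lborel (indicator {0..1}))"
    by (subst distr_norm_squared[symmetric], subst nn_integral_distr) auto
  also have "\<dots> = (\<integral>\<^sup>+t\<in>{0..1}. \<phi> t \<partial>lborel)"
    by (subst nn_integral_density) (auto simp: mult.commute)
  finally show ?thesis .
qed

text \<open>In the variable t = |z|^2 this is the integral of t^n (1 - t), that is 1 / (n + 1) - 1 /
  (n + 2).\<close>

lemma nn_integral_disk_monomial:
  "(\<integral>\<^sup>+z\<in>unit_disk. ennreal ((norm z) ^ (2 * n) * (1 - (norm z)\<^sup>2)) \<partial>m2)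
    = ennreal (1 / ((real n + 1) * (real n + 2)))"
proof -
  define P :: "real \<Rightarrow> real" where "P t = t ^ (n + 1) / (real n + 1) - t ^ (n + 2) / (real n + 2)" for t
  have "(\<integral>\<^sup>+z\<in>unit_disk. ennreal ((norm z) ^ (2 * n) * (1 - (norm z)\<^sup>2)) \<partial>m2)
      = (\<integral>\<^sup>+t\<in>{0..1}. ennreal (t ^ n * (1 - t)) \<partial>lborel)"
    using nn_integral_radial[of "\<lambda>t. ennreal (t ^ n * (1 - t))"] by (simp add: power_mult)
  also have "\<dots> = ennreal (P 1 - P 0)"
  proof (rule nn_integral_FTC_Icc)
    fix t :: real
    show "(P has_real_derivative t ^ n * (1 - t)) (at t)"
    proof -
      have D: "((\<lambda>t. t ^ Suc k / (real k + 1)) has_real_derivative t ^ k) (at t)" for k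
        using DERIV_cdivide[OF DERIV_pow[of "Suc k" t], of "real k + 1"] by (simp add: add.commute)
      show ?thesis
        using DERIV_diff[OF D[of n] D[of "Suc n"]] unfolding P_def[abs_def]
        by (simp add: algebra_simps)
    qed
  qed auto
  also have "P 1 - P 0 = 1 / ((real n + 1) * (real n + 2))"
    by (simp add: P_def field_simps)
  finally show ?thesis .
qed

subsection \<open>The norm of the weighted Bergman space\<close>

text \<open>Half the squared norm, taken in \<open>ennreal\<close>: it makes sense before
  integrability is known, finiteness expresses membership in the space, and Tonelli and Fatou apply
  directly.\<close>

definition disk_energy :: "(complex \<Rightarrow> complex) \<Rightarrow> ennreal" where
  "disk_energy g = (\<integral>\<^sup>+z\<in>unit_disk. ennreal ((norm (g z))\<^sup>2 * (1 - (norm z)\<^sup>2)) \<partial>m2)"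

lemma disk_weight_nonneg: "norm (z :: complex) < 1 \<Longrightarrow> 0 \<le> 1 - (norm z)\<^sup>2"
  by (simp add: power_le_one)

lemma disk_density_nonneg: "norm (z :: complex) < 1 \<Longrightarrow> 0 \<le> (norm (w :: complex))\<^sup>2 * (1 - (norm z)\<^sup>2)"
  by (intro mult_nonneg_nonneg disk_weight_nonneg) auto

lemma disk_density_measurable:
  assumes "g holomorphic_on unit_disk"
  shows "(\<lambda>z. ennreal ((norm (g z))\<^sup>2 * (1 - (norm z)\<^sup>2)) * indicator unit_disk z) \<in> borel_measurable borel"
proof -
  have [measurable]: "(\<lambda>z. indicator unit_disk z *\<^sub>R g z) \<in> borel_measurable borel"
    using assms by (intro borel_measurable_continuous_on_indicator holomorphic_on_imp_continuous_on) simp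
  have "(\<lambda>z. ennreal ((norm (indicator unit_disk z *\<^sub>R g z))\<^sup>2 * (1 - (norm z)\<^sup>2))) \<in> borel_measurable borel"
    by measurable
  also have "(\<lambda>z. ennreal ((norm (indicator unit_disk z *\<^sub>R g z))\<^sup>2 * (1 - (norm z)\<^sup>2)))
      = (\<lambda>z. ennreal ((norm (g z))\<^sup>2 * (1 - (norm z)\<^sup>2)) * indicator unit_disk z)"
    by (auto split: split_indicator)
  finally show ?thesis .
qed

text \<open>Rotation invariance allows averaging the density over all rotations. On each circle
  Parseval separates the monomials, and Tonelli exchanges the two integrals.\<close>

lemma disk_energy_power_series:
  assumes hol: "g holomorphic_on unit_disk"
    and sums: "\<And>z. z \<in> unit_disk \<Longrightarrow> (\<lambda>n. a n * z ^ n) sums g z"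
  shows "disk_energy g = (\<Sum>n. ennreal ((norm (a n))\<^sup>2 / ((real n + 1) * (real n + 2))))"
proof -
  define F where "F z = ennreal ((norm (g z))\<^sup>2 * (1 - (norm z)\<^sup>2)) * indicator unit_disk z" for z
  have F [measurable]: "F \<in> borel_measurable borel"
    using disk_density_measurable[OF hol] by (simp add: F_def[abs_def])
  have [measurable]: "circ \<in> borel_measurable borel"
    using continuous_on_circ[OF continuous_on_id] by (intro borel_measurable_continuous_onI)
  define M where "M n z = ennreal (norm z ^ (2 * n) * (1 - (norm z)\<^sup>2)) * indicator unit_disk z"
    for n and z :: complex
  have [measurable]: "M n \<in> borel_measurable borel" for n
    unfolding M_def[abs_def] by measurable
  have inner: "(\<integral>\<^sup>+t. F (circ t * z) * indicator {0..1} t \<partial>lborel) = (\<Sum>n. ennreal ((norm (a n))\<^sup>2) * M n z)" for z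
  proof (cases "z \<in> unit_disk")
    case False
    then show ?thesis by (simp add: F_def M_def norm_mult)
  next
    case True
    then have z: "norm z < 1" by simp
    have s: "summable (\<lambda>n. norm (a n * z ^ n))"
      by (rule power_series_abs_summable[OF sums z]) simp
    have eq: "(\<Sum>n. a n * z ^ n * circ t ^ n) = g (circ t * z)" for t
      using sums[of "circ t * z"] z by (simp add: sums_iff norm_mult power_mult_distrib mult_ac)
    have "((\<lambda>t. (norm (g (circ t * z)))\<^sup>2 * (1 - (norm z)\<^sup>2)) has_integral
        (\<Sum>n. (norm (a n * z ^ n))\<^sup>2) * (1 - (norm z)\<^sup>2)) {0..1}"
      using parseval(1)[OF s] unfolding eq by (rule has_integral_mult_left)
    then have "(\<integral>\<^sup>+t. ennreal ((norm (g (circ t * z)))\<^sup>2 * (1 - (norm z)\<^sup>2)) * indicator {0..1} t \<partial>lborel)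
        = ennreal ((\<Sum>n. (norm (a n * z ^ n))\<^sup>2) * (1 - (norm z)\<^sup>2))"
      by (intro nn_integral_has_integral_lebesgue') (use disk_weight_nonneg[OF z] in auto)
    also have "\<dots> = (\<Sum>n. ennreal ((norm (a n * z ^ n))\<^sup>2)) * ennreal (1 - (norm z)\<^sup>2)"
      using parseval(2)[OF s] disk_weight_nonneg[OF z]
      by (simp add: suminf_ennreal2 ennreal_mult suminf_nonneg)
    also have "\<dots> = (\<Sum>n. ennreal ((norm (a n * z ^ n))\<^sup>2) * ennreal (1 - (norm z)\<^sup>2))"
      by simp
    also have "\<dots> = (\<Sum>n. ennreal ((norm (a n))\<^sup>2) * M n z)"
      using True disk_weight_nonneg[OF z]
      by (intro suminf_cong)
         (simp add: M_def norm_mult norm_power power_mult_distrib ennreal_mult'[symmetric] mult.assoc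
            power_mult[symmetric] mult.commute[of _ 2])
    finally show ?thesis using z by (simp add: F_def norm_mult)
  qed
  \<comment> \<open>The unit interval has length 1, so an average over \<open>t\<close> can be
    inserted, and each rotated integrand has the same integral.\<close>
  have "(\<integral>\<^sup>+z. F z \<partial>lborel) = (\<integral>\<^sup>+t. (\<integral>\<^sup>+z. F z \<partial>lborel) * indicator {0..1} t \<partial>(lborel :: real measure))"
    by (subst nn_integral_cmult) auto
  also have "\<dots> = (\<integral>\<^sup>+t. (\<integral>\<^sup>+z. F (circ t * z) * indicator {0..1} t \<partial>lborel) \<partial>lborel)"
    by (subst nn_integral_multc) (auto simp: nn_integral_rotate[OF F])
  also have "\<dots> = (\<integral>\<^sup>+z. (\<integral>\<^sup>+t. F (circ t * z) * indicator {0..1} t \<partial>lborel) \<partial>lborel)"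
    by (rule lborel_pair.Fubini'[symmetric]) measurable
  also have "\<dots> = (\<Sum>n. ennreal ((norm (a n))\<^sup>2) * (\<integral>\<^sup>+z. M n z \<partial>lborel))"
    unfolding inner by (subst nn_integral_suminf) (auto simp: nn_integral_cmult)
  finally have "(\<integral>\<^sup>+z. F z \<partial>m2) = (\<Sum>n. ennreal ((norm (a n))\<^sup>2) * (\<integral>\<^sup>+z. M n z \<partial>m2))"
    by (simp add: nn_integral_m2 ennreal_suminf_cmult[symmetric] mult.left_commute del: ennreal_suminf_cmult)
  moreover have "(\<integral>\<^sup>+z. M n z \<partial>m2) = ennreal (1 / ((real n + 1) * (real n + 2)))" for n
    unfolding M_def by (rule nn_integral_disk_monomial)
  ultimately show ?thesis
    unfolding disk_energy_def F_def by (simp add: ennreal_mult'[symmetric])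
qed

lemma bergman1_iff: "f \<in> bergman1 \<longleftrightarrow> f holomorphic_on unit_disk \<and> disk_energy f < \<infinity>"
proof -
  have "set_integrable m2 unit_disk (\<lambda>z. (norm (f z))\<^sup>2 * (1 - (norm z)\<^sup>2)) \<longleftrightarrow> disk_energy f < \<infinity>"
    if "f holomorphic_on unit_disk"
  proof -
    let ?h = "\<lambda>z. indicator unit_disk z *\<^sub>R ((norm (f z))\<^sup>2 * (1 - (norm z)\<^sup>2))"
    have "continuous_on unit_disk f" using that by (rule holomorphic_on_imp_continuous_on)
    then have m: "?h \<in> borel_measurable m2"
      unfolding measurable_cong_sets[OF sets_m2 refl]
      by (intro borel_measurable_continuous_on_indicator continuous_intros) auto
    have "(\<integral>\<^sup>+z. ennreal (norm (?h z)) \<partial>m2) = disk_energy f"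
      unfolding disk_energy_def
      by (intro nn_integral_cong) (auto split: split_indicator simp: disk_density_nonneg simp del: abs_mult)
    with m show ?thesis by (simp add: set_integrable_def integrable_iff_bounded)
  qed
  then show ?thesis by (auto simp: bergman1_def)
qed

text \<open>This also covers infinite energy: the Bochner integral and \<open>enn2real\<close> then
  both take the default value 0.\<close>

lemma bergman1_norm_eq:
  assumes "f holomorphic_on unit_disk"
  shows "bergman1_norm f = sqrt (2 * enn2real (disk_energy f))"
proof -
  let ?h = "\<lambda>z. indicator unit_disk z *\<^sub>R ((norm (f z))\<^sup>2 * (1 - (norm z)\<^sup>2))"
  have "continuous_on unit_disk f" using assms by (rule holomorphic_on_imp_continuous_on)
  then have m: "?h \<in> borel_measurable m2"
    unfolding measurable_cong_sets[OF sets_m2 refl]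
    by (intro borel_measurable_continuous_on_indicator continuous_intros) auto
  have "(\<integral>z. ?h z \<partial>m2) = enn2real (\<integral>\<^sup>+z. ennreal (?h z) \<partial>m2)"
    by (rule integral_eq_nn_integral[OF m], rule AE_I2) (auto split: split_indicator simp: disk_density_nonneg)
  also have "(\<integral>\<^sup>+z. ennreal (?h z) \<partial>m2) = disk_energy f"
    unfolding disk_energy_def by (intro nn_integral_cong) (auto split: split_indicator)
  finally show ?thesis by (simp add: bergman1_norm_def set_lebesgue_integral_def)
qed

lemma bergman1_norm_nonneg [simp]: "0 \<le> bergman1_norm f"
  unfolding bergman1_norm_def set_lebesgue_integral_def
  by (auto intro!: integral_nonneg_AE AE_I2 split: split_indicator simp: disk_density_nonneg)

lemma disk_energy_bergman1:
  assumes "f \<in> bergman1"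
  shows "disk_energy f = ennreal ((bergman1_norm f)\<^sup>2 / 2)"
  using assms by (cases "disk_energy f") (auto simp: bergman1_iff bergman1_norm_eq)

lemma bergman1_norm_le:
  assumes "f holomorphic_on unit_disk" "disk_energy f \<le> ennreal (c\<^sup>2 / 2)" "0 \<le> c"
  shows "f \<in> bergman1" "bergman1_norm f \<le> c"
proof -
  show f: "f \<in> bergman1"
    using assms by (auto simp: bergman1_iff intro: le_less_trans)
  have "(bergman1_norm f)\<^sup>2 \<le> c\<^sup>2"
    using assms(2) unfolding disk_energy_bergman1[OF f] by (simp add: ennreal_le_iff)
  then show "bergman1_norm f \<le> c" using assms(3) by (rule power2_le_imp_le)
qed

text \<open>The mixed term is absorbed by 2 |x| |y| <= t |x|^2 + |y|^2 / t. The free weight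
  \<open>t\<close> replaces the Cauchy-Schwarz inequality: its optimal choice gives the triangle
  inequality.\<close>

lemma disk_energy_add_le:
  assumes f: "f holomorphic_on unit_disk" and g: "g holomorphic_on unit_disk" and t: "0 < t"
  shows "disk_energy (\<lambda>z. f z + g z) \<le> ennreal (1 + t) * disk_energy f + ennreal (1 + 1 / t) * disk_energy g"
proof -
  have sq: "(norm (x + y))\<^sup>2 \<le> (1 + t) * (norm x)\<^sup>2 + (1 + 1 / t) * (norm y)\<^sup>2" for x y :: complex
  proof -
    have "0 \<le> (t * norm x - norm y)\<^sup>2 / t" using t by simp
    also have "\<dots> = t * (norm x)\<^sup>2 + (norm y)\<^sup>2 / t - 2 * norm x * norm y"
      using t by (simp add: power2_eq_square field_simps)
    finally have "(norm x + norm y)\<^sup>2 \<le> (1 + t) * (norm x)\<^sup>2 + (1 + 1 / t) * (norm y)\<^sup>2"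
      by (simp add: power2_eq_square algebra_simps)
    moreover have "(norm (x + y))\<^sup>2 \<le> (norm x + norm y)\<^sup>2"
      by (intro power_mono norm_triangle_ineq) simp
    ultimately show ?thesis by linarith
  qed
  let ?d = "\<lambda>f z. ennreal ((norm (f z :: complex))\<^sup>2 * (1 - (norm z)\<^sup>2)) * indicator unit_disk z"
  have [measurable]: "?d f \<in> borel_measurable borel" "?d g \<in> borel_measurable borel"
    using disk_density_measurable f g by blast+
  have "disk_energy (\<lambda>z. f z + g z) \<le> (\<integral>\<^sup>+z. ennreal (1 + t) * ?d f z + ennreal (1 + 1 / t) * ?d g z \<partial>m2)"
    unfolding disk_energy_def
  proof (intro nn_integral_mono)
    fix z
    show "?d (\<lambda>z. f z + g z) z \<le> ennreal (1 + t) * ?d f z + ennreal (1 + 1 / t) * ?d g z"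
    proof (cases "z \<in> unit_disk")
      case True
      then have w: "0 \<le> 1 - (norm z)\<^sup>2" by (intro disk_weight_nonneg) simp
      have "(norm (f z + g z))\<^sup>2 * (1 - (norm z)\<^sup>2)
          \<le> ((1 + t) * (norm (f z))\<^sup>2 + (1 + 1 / t) * (norm (g z))\<^sup>2) * (1 - (norm z)\<^sup>2)"
        by (intro mult_right_mono sq w)
      also have "\<dots> = (1 + t) * ((norm (f z))\<^sup>2 * (1 - (norm z)\<^sup>2)) + (1 + 1 / t) * ((norm (g z))\<^sup>2 * (1 - (norm z)\<^sup>2))"
        by (simp only: distrib_right mult.assoc)
      finally have "ennreal ((norm (f z + g z))\<^sup>2 * (1 - (norm z)\<^sup>2)) \<le> ennreal \<dots>"
        by (rule ennreal_leI)
      also have "\<dots> = ennreal (1 + t) * ennreal ((norm (f z))\<^sup>2 * (1 - (norm z)\<^sup>2))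
          + ennreal (1 + 1 / t) * ennreal ((norm (g z))\<^sup>2 * (1 - (norm z)\<^sup>2))"
        using w t by (subst ennreal_plus) (auto simp: ennreal_mult)
      finally show ?thesis using True by simp
    qed simp
  qed
  also have "\<dots> = ennreal (1 + t) * disk_energy f + ennreal (1 + 1 / t) * disk_energy g"
    unfolding disk_energy_def
    by (subst nn_integral_add) (auto simp: nn_integral_cmult)
  finally show ?thesis .
qed

lemma bergman1_triangle:
  assumes f: "f \<in> bergman1" and g: "g \<in> bergman1"
  shows "(\<lambda>z. f z + g z) \<in> bergman1" "bergman1_norm (\<lambda>z. f z + g z) \<le> bergman1_norm f + bergman1_norm g"
proof -
  let ?A = "bergman1_norm f" and ?B = "bergman1_norm g"
  have h: "f holomorphic_on unit_disk" "g holomorphic_on unit_disk"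
    using f g by (auto simp: bergman1_iff)
  have hs: "(\<lambda>z. f z + g z) holomorphic_on unit_disk"
    by (intro holomorphic_intros h)
  have *: "(\<lambda>z. f z + g z) \<in> bergman1 \<and> bergman1_norm (\<lambda>z. f z + g z) \<le> ?A + ?B + e" if e: "e > 0" for e
  proof -
    \<comment> \<open>The optimal weight is the ratio of the two norms; adding \<open>e / 2\<close>
      keeps both numbers positive when a norm vanishes.\<close>
    define a b where "a = ?A + e / 2" and "b = ?B + e / 2"
    have ab: "?A \<le> a" "?B \<le> b" "0 < a" "0 < b"
      using e bergman1_norm_nonneg[of f] bergman1_norm_nonneg[of g] unfolding a_def b_def by linarith+
    have "disk_energy (\<lambda>z. f z + g z)
        \<le> ennreal (1 + b / a) * disk_energy f + ennreal (1 + 1 / (b / a)) * disk_energy g"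
      using ab by (intro disk_energy_add_le h) simp
    also have "\<dots> \<le> ennreal (1 + b / a) * ennreal (a\<^sup>2 / 2) + ennreal (1 + 1 / (b / a)) * ennreal (b\<^sup>2 / 2)"
      unfolding disk_energy_bergman1[OF f] disk_energy_bergman1[OF g] using ab
      by (intro add_mono mult_left_mono ennreal_leI divide_right_mono power_mono) auto
    also have "\<dots> = ennreal ((1 + b / a) * (a\<^sup>2 / 2) + (1 + 1 / (b / a)) * (b\<^sup>2 / 2))"
      using ab by (simp add: ennreal_mult'[symmetric] ennreal_plus[symmetric] del: ennreal_plus)
    also have "(1 + b / a) * (a\<^sup>2 / 2) + (1 + 1 / (b / a)) * (b\<^sup>2 / 2) = (a + b)\<^sup>2 / 2"
      using ab by (simp add: field_simps power2_eq_square)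
    finally have "disk_energy (\<lambda>z. f z + g z) \<le> ennreal ((a + b)\<^sup>2 / 2)" .
    from bergman1_norm_le[OF hs this] ab show ?thesis by (auto simp: a_def b_def)
  qed
  from *[of 1] show "(\<lambda>z. f z + g z) \<in> bergman1" by simp
  show "bergman1_norm (\<lambda>z. f z + g z) \<le> ?A + ?B"
    by (rule field_le_epsilon) (use * in blast)
qed

lemma bergman1_minus:
  assumes "f \<in> bergman1"
  shows "(\<lambda>z. - f z) \<in> bergman1" "bergman1_norm (\<lambda>z. - f z) = bergman1_norm f"
  using assms by (auto simp: bergman1_iff disk_energy_def bergman1_norm_def intro!: holomorphic_intros)

lemma bergman1_diff:
  assumes "f \<in> bergman1" "g \<in> bergman1"
  shows "(\<lambda>z. f z - g z) \<in> bergman1" "bergman1_norm (\<lambda>z. f z - g z) \<le> bergman1_norm f + bergman1_norm g"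
  using bergman1_triangle[OF assms(1) bergman1_minus(1)[OF assms(2)]] bergman1_minus(2)[OF assms(2)] by simp_all

text \<open>With \<open>g = \<Sum> b\<^sub>n z\<^sup>n\<close> the energy of \<open>g'\<close> is \<open>\<Sum> n / (n + 1) |b\<^sub>n|\<^sup>2\<close>.\<close>
lemma disk_energy_deriv_le:
  assumes g: "g holomorphic_on ball 0 R" and R: "R > 1"
    and I: "((\<lambda>t. (norm (g (circ t)))\<^sup>2) has_integral I) {0..1}"
  shows "disk_energy (deriv g) \<le> ennreal I"
proof -
  define b where "b n = (deriv ^^ n) g 0 / fact n" for n
  have b: "(\<lambda>n. b n * z ^ n) sums g z" if "z \<in> ball 0 R" for z
    using holomorphic_power_series[OF g that] by (simp add: b_def)
  have hol: "deriv g holomorphic_on unit_disk"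
    using R by (intro holomorphic_on_subset[OF holomorphic_deriv[OF g]]) auto
  have d: "(\<lambda>n. (of_nat (Suc n) * b (Suc n)) * z ^ n) sums deriv g z" if "z \<in> unit_disk" for z
  proof -
    have "(\<lambda>n. (deriv ^^ n) (deriv g) 0 / fact n * z ^ n) sums deriv g z"
      using holomorphic_power_series[OF hol that] by simp
    moreover have "(deriv ^^ n) (deriv g) 0 / fact n = of_nat (Suc n) * b (Suc n)" for n
      unfolding b_def using of_nat_neq_0[where 'a = complex, of n]
      by (simp add: funpow_Suc_right del: funpow.simps)
    ultimately show ?thesis by simp
  qed
  have s: "summable (\<lambda>n. norm (b n))"
    using power_series_abs_summable[OF b, of R 1] R by simp
  have "(\<Sum>n. b n * circ t ^ n) = g (circ t)" for t
    using b[of "circ t"] R by (simp add: sums_iff)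
  with parseval[OF s] have "((\<lambda>t. (norm (g (circ t)))\<^sup>2) has_integral (\<Sum>n. (norm (b n))\<^sup>2)) {0..1}"
    by simp
  with I have I_eq: "I = (\<Sum>n. (norm (b n))\<^sup>2)" by (rule has_integral_unique)
  have s2: "summable (\<lambda>n. (norm (b (Suc n)))\<^sup>2)"
    using parseval(2)[OF s] by (subst summable_Suc_iff)
  have "disk_energy (deriv g)
      = (\<Sum>n. ennreal ((norm (of_nat (Suc n) * b (Suc n)))\<^sup>2 / ((real n + 1) * (real n + 2))))"
    by (rule disk_energy_power_series[OF hol d])
  also have "\<dots> \<le> (\<Sum>n. ennreal ((norm (b (Suc n)))\<^sup>2))"
  proof (intro suminf_le ennreal_leI)
    fix n
    have "x\<^sup>2 * y\<^sup>2 / (x * (x + 1)) = x / (x + 1) * y\<^sup>2" for x y :: real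
      by (simp add: power2_eq_square)
    from this[of "real n + 1" "norm (b (Suc n))"]
    have "(norm (of_nat (Suc n) * b (Suc n)))\<^sup>2 / ((real n + 1) * (real n + 2))
        = (real n + 1) / (real n + 2) * (norm (b (Suc n)))\<^sup>2"
      by (subst norm_mult, subst norm_of_nat) (simp add: power_mult_distrib add_ac)
    also have "\<dots> \<le> 1 * (norm (b (Suc n)))\<^sup>2"
      by (intro mult_right_mono) auto
    finally show "(norm (of_nat (Suc n) * b (Suc n)))\<^sup>2 / ((real n + 1) * (real n + 2)) \<le> (norm (b (Suc n)))\<^sup>2"
      by simp
  qed auto
  also have "\<dots> = ennreal (\<Sum>n. (norm (b (Suc n)))\<^sup>2)"
    by (intro suminf_ennreal2 s2) simp
  \<comment> \<open>Differentiation has removed the constant coefficient, whose square is simply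
    dropped.\<close>
  also have "(\<Sum>n. (norm (b (Suc n)))\<^sup>2) \<le> I"
    unfolding I_eq using suminf_split_head[OF parseval(2)[OF s]] by simp
  finally show ?thesis by (simp add: ennreal_leI)
qed

subsection \<open>Upper bound\<close>

lemma disk_energy_cong:
  "(\<And>z. z \<in> unit_disk \<Longrightarrow> f z = g z) \<Longrightarrow> disk_energy f = disk_energy g"
  unfolding disk_energy_def by (intro nn_integral_cong) (auto split: split_indicator)

text \<open>\<open>B' / (1 - B)\<close> is the derivative of \<open>\<Sum> B\<^sup>k / k\<close>, and the powers of an inner function
  vanishing at the origin are orthonormal on the circle.\<close>
lemma disk_energy_inner_log_deriv:
  assumes B: "B holomorphic_on ball 0 R" and R: "R > 1" and B0: "B 0 = 0"
    and circle: "\<And>t. norm (B (circ t)) = 1" and disk: "\<And>z. norm z < 1 \<Longrightarrow> norm (B z) < 1"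
  shows "disk_energy (\<lambda>z. deriv B z / (1 - B z)) \<le> ennreal (pi\<^sup>2 / 6)"
proof -
  \<comment> \<open>Partial sums of - log (1 - B). They stay holomorphic across the circle, whereas
    the logarithm is singular where B = 1.\<close>
  define S where "S K z = (\<Sum>k<K. B z ^ Suc k / of_nat (Suc k))" for K z
  have S_hol: "S K holomorphic_on ball 0 R" for K
    unfolding S_def by (intro holomorphic_intros B) auto
  have sq: "B (circ t) * cnj (B (circ t)) = 1" for t
    using complex_norm_square[of "B (circ t)"] circle[of t] by simp
  have power_mean: "((\<lambda>t. B (circ t) ^ Suc m) has_integral 0) {0..1}" for m
    using mean_value_circle[OF holomorphic_on_power[OF B] R, of "Suc m"] B0 by simp
  \<comment> \<open>On the circle B times its conjugate is 1. The common powers cancel, and what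
    remains for distinct exponents is a positive power of B or its conjugate, of mean zero since
    B(0) = 0.\<close>
  have ortho: "((\<lambda>t. B (circ t) ^ a * cnj (B (circ t) ^ b)) has_integral (if a = b then 1 else 0)) {0..1}" for a b
  proof -
    consider "a = b" | m where "a = b + Suc m" | m where "b = a + Suc m"
      by (metis less_imp_Suc_add linorder_neqE_nat add_Suc_right)
    then show ?thesis
    proof cases
      case 1
      then have "B (circ t) ^ a * cnj (B (circ t) ^ b) = 1" for t
        by (simp add: power_mult_distrib[symmetric] sq)
      then show ?thesis using 1 has_integral_const_real[of "1::complex" 0 1] by simp
    next
      case 2
      have eq: "B (circ t) ^ a * cnj (B (circ t) ^ b) = (B (circ t) * cnj (B (circ t))) ^ b * B (circ t) ^ Suc m" for t
        unfolding 2 by (simp add: power_add power_mult_distrib)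
      have "a \<noteq> b" using 2 by simp
      then show ?thesis unfolding eq sq using power_mean[of m] by simp
    next
      case 3
      have eq: "B (circ t) ^ a * cnj (B (circ t) ^ b) = (B (circ t) * cnj (B (circ t))) ^ a * cnj (B (circ t) ^ Suc m)" for t
        unfolding 3 by (simp add: power_add power_mult_distrib)
      have "a \<noteq> b" using 3 by simp
      then show ?thesis unfolding eq sq using has_integral_cnj[THEN iffD2, OF power_mean[of m]] by (simp add: o_def)
    qed
  qed
  have S_energy: "disk_energy (deriv (S K)) \<le> ennreal (pi\<^sup>2 / 6)" for K
  proof -
    let ?c = "\<lambda>k. complex_of_real (1 / real (Suc k))"
    have "((\<lambda>t. \<Sum>k<K. \<Sum>l<K. (?c k * ?c l) * (B (circ t) ^ Suc k * cnj (B (circ t) ^ Suc l))) has_integral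
        (\<Sum>k<K. \<Sum>l<K. (?c k * ?c l) * (if Suc k = Suc l then 1 else 0))) {0..1}"
      by (intro has_integral_sum has_integral_mult_right ortho) auto
    moreover have "(\<Sum>k<K. \<Sum>l<K. (?c k * ?c l) * (B (circ t) ^ Suc k * cnj (B (circ t) ^ Suc l)))
        = of_real ((norm (S K (circ t)))\<^sup>2)" for t
    proof -
      have "S K (circ t) = (\<Sum>k<K. ?c k * B (circ t) ^ Suc k)"
        unfolding S_def by (intro sum.cong refl) (simp add: divide_inverse mult.commute)
      then show ?thesis
        unfolding complex_norm_square
        by (simp only: cnj_sum sum_product complex_cnj_mult complex_cnj_complex_of_real mult_ac)
    qed
    moreover have "(\<Sum>k<K. \<Sum>l<K. (?c k * ?c l) * (if Suc k = Suc l then 1 else 0))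
        = of_real (\<Sum>k<K. 1 / (real k + 1)\<^sup>2)"
      by (simp add: sum.delta' if_distrib power2_eq_square add.commute cong: if_cong)
    ultimately have "((\<lambda>t. complex_of_real ((norm (S K (circ t)))\<^sup>2)) has_integral
        of_real (\<Sum>k<K. 1 / (real k + 1)\<^sup>2)) {0..1}" by simp
    from has_integral_Re[OF this]
    have "((\<lambda>t. (norm (S K (circ t)))\<^sup>2) has_integral (\<Sum>k<K. 1 / (real k + 1)\<^sup>2)) {0..1}"
      unfolding Re_complex_of_real .
    then have "disk_energy (deriv (S K)) \<le> ennreal (\<Sum>k<K. 1 / (real k + 1)\<^sup>2)"
      by (rule disk_energy_deriv_le[OF S_hol R])
    also have "(\<Sum>k<K. 1 / (real k + 1)\<^sup>2) \<le> pi\<^sup>2 / 6"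
    proof -
      have "(\<lambda>k. 1 / (real k + 1)\<^sup>2) sums (pi\<^sup>2 / 6)"
        using inverse_squares_sums by (simp add: add.commute)
      then show ?thesis
        using sum_le_suminf[of "\<lambda>k. 1 / (real k + 1)\<^sup>2" "{..<K}"] by (simp add: sums_iff)
    qed
    finally show ?thesis by (simp add: ennreal_leI)
  qed
  have lim: "(\<lambda>K. deriv (S K) z) \<longlonglongrightarrow> deriv B z / (1 - B z)" if "norm z < 1" for z
  proof -
    have "z \<in> ball 0 R" using that R by simp
    then have dB: "(B has_field_derivative deriv B z) (at z)"
      using holomorphic_derivI[OF B] by simp
    have dS: "deriv (S K) z = (\<Sum>k<K. B z ^ k) * deriv B z" for K
    proof (rule DERIV_imp_deriv)
      have "((\<lambda>z. B z ^ Suc k / of_nat (Suc k)) has_field_derivative B z ^ k * deriv B z) (at z)" for k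
      proof -
        have "of_nat (Suc k) * (deriv B z * B z ^ (Suc k - Suc 0)) / of_nat (Suc k) = B z ^ k * deriv B z"
          using of_nat_neq_0[where 'a = complex, of k] by (simp del: of_nat_Suc)
        then show ?thesis by (rule DERIV_cong[OF DERIV_cdivide[OF DERIV_power[OF dB]]])
      qed
      then show "(S K has_field_derivative (\<Sum>k<K. B z ^ k) * deriv B z) (at z)"
        unfolding S_def[abs_def] sum_distrib_right by (intro DERIV_sum)
    qed
    have "(\<lambda>K. \<Sum>k<K. B z ^ k) \<longlonglongrightarrow> 1 / (1 - B z)"
      using geometric_sums[OF disk[OF that]] by (simp add: sums_def)
    from tendsto_mult[OF this tendsto_const[of "deriv B z"]] show ?thesis
      unfolding dS by simp
  qed
  define d where "d g z = ennreal ((norm (g z :: complex))\<^sup>2 * (1 - (norm z)\<^sup>2)) * indicator unit_disk z" for g z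
  have [measurable]: "d (deriv (S K)) \<in> borel_measurable borel" for K
    unfolding d_def[abs_def]
    using R by (intro disk_density_measurable holomorphic_on_subset[OF holomorphic_deriv[OF S_hol]]) auto
  \<comment> \<open>Fatou's lemma: the derivatives of the partial sums converge pointwise in the
    disk, and their energies have a common bound.\<close>
  have "disk_energy (\<lambda>z. deriv B z / (1 - B z)) = (\<integral>\<^sup>+z. liminf (\<lambda>K. d (deriv (S K)) z) \<partial>m2)"
    unfolding disk_energy_def
  proof (intro nn_integral_cong)
    fix z
    have "(\<lambda>K. d (deriv (S K)) z) \<longlonglongrightarrow> d (\<lambda>z. deriv B z / (1 - B z)) z"
      unfolding d_def
      by (cases "z \<in> unit_disk") (auto intro!: tendsto_ennrealI tendsto_intros lim)
    from lim_imp_Liminf[OF _ this]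
    show "ennreal ((norm (deriv B z / (1 - B z)))\<^sup>2 * (1 - (norm z)\<^sup>2)) * indicator unit_disk z
        = liminf (\<lambda>K. d (deriv (S K)) z)"
      by (simp add: d_def)
  qed
  also have "\<dots> \<le> liminf (\<lambda>K. \<integral>\<^sup>+z. d (deriv (S K)) z \<partial>m2)"
    by (rule nn_integral_liminf) simp
  also have "\<dots> \<le> ennreal (pi\<^sup>2 / 6)"
    by (rule Liminf_le) (use S_energy in \<open>auto simp: d_def disk_energy_def\<close>)
  finally show ?thesis .
qed

section \<open>Polynomials with all zeros on the circle\<close>

lemma log_deriv_prod_linear:
  fixes w :: "nat \<Rightarrow> complex"
  assumes "\<And>j. j < n \<Longrightarrow> z \<noteq> w j"
  shows "poly (pderiv (\<Prod>j<n. [:- w j, 1:])) z / poly (\<Prod>j<n. [:- w j, 1:]) z = (\<Sum>j<n. 1 / (z - w j))"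
  using assms
proof (induction n)
  case (Suc n)
  let ?P = "\<Prod>j<n. [:- w j, 1:]"
  have "poly ?P z \<noteq> 0" using Suc.prems by (simp add: poly_prod)
  moreover have "z - w n \<noteq> 0" using Suc.prems[of n] by simp
  moreover have "poly (pderiv ([:- w n, 1:] * ?P)) z = (z - w n) * poly (pderiv ?P) z + poly ?P z"
    by (simp only: pderiv_mult poly_add poly_mult) (simp add: pderiv_pCons)
  ultimately have "poly (pderiv ([:- w n, 1:] * ?P)) z / poly ([:- w n, 1:] * ?P) z
      = poly (pderiv ?P) z / poly ?P z + 1 / (z - w n)"
    by (simp add: add_frac_eq) (simp add: field_simps)
  then show ?case using Suc.IH Suc.prems by (simp add: mult.commute)
qed simp

text \<open>The conjugate reciprocal polynomial z^n conj (Q (1 / conj z)) with n = degree Q.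
  Reversing the coefficients defines it as a polynomial, at the origin too.\<close>

definition conj_reflect :: "complex poly \<Rightarrow> complex poly" where
  "conj_reflect Q = reflect_poly (map_poly cnj Q)"

lemma poly_conj_reflect:
  assumes "z \<noteq> 0"
  shows "poly (conj_reflect Q) z = z ^ degree Q * cnj (poly Q (inverse (cnj z)))"
proof -
  have "degree (map_poly cnj Q) = degree Q" by (rule degree_map_poly) simp
  moreover have "cnj (poly Q (inverse (cnj z))) = poly (map_poly cnj Q) (inverse z)"
    by (subst poly_cnj) simp
  ultimately show ?thesis
    unfolding conj_reflect_def poly_reflect_poly_nz[OF assms] by simp
qed

text \<open>Reversal turns the constant coefficient into the leading one, so it must not
  vanish.\<close>

lemma degree_conj_reflect: "coeff Q 0 \<noteq> 0 \<Longrightarrow> degree (conj_reflect Q) = degree Q"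
  by (simp add: conj_reflect_def coeff_map_poly degree_map_poly)

lemma norm_conj_reflect_circle:
  assumes "norm z = 1"
  shows "norm (poly (conj_reflect Q) z) = norm (poly Q z)"
proof -
  have "z \<noteq> 0" using assms by auto
  have inv: "inverse (cnj z) = z"
    using complex_norm_square[of z] assms by (intro inverse_unique) (simp add: mult.commute)
  show ?thesis
    unfolding poly_conj_reflect[OF \<open>z \<noteq> 0\<close>] inv by (simp add: norm_mult norm_power assms)
qed

text \<open>Maximum principle for the quotient, which is holomorphic as Q has no zeros there and is
  unimodular on the circle.\<close>

lemma norm_conj_reflect_disk:
  assumes Q: "\<And>z. norm z < R \<Longrightarrow> poly Q z \<noteq> 0" and R: "R > 1" and z: "norm z \<le> 1"
  shows "norm (poly (conj_reflect Q) z) \<le> norm (poly Q z)"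
proof -
  have nz: "poly Q z \<noteq> 0" if "norm z \<le> 1" for z
    using Q[of z] that R by simp
  have "norm (poly (conj_reflect Q) z / poly Q z) \<le> 1"
  proof (rule maximum_modulus_frontier[where S = "cball 0 1" and f = "\<lambda>z. poly (conj_reflect Q) z / poly Q z"])
    show "(\<lambda>z. poly (conj_reflect Q) z / poly Q z) holomorphic_on interior (cball 0 1)"
      by (intro holomorphic_intros nz) auto
    show "continuous_on (closure (cball 0 1)) (\<lambda>z. poly (conj_reflect Q) z / poly Q z)"
      by (intro continuous_intros ballI nz) auto
    show "norm (poly (conj_reflect Q) z / poly Q z) \<le> 1" if "z \<in> frontier (cball 0 1)" for z
      using that norm_conj_reflect_circle[of z Q] by (simp add: norm_divide)
  qed (use z in auto)
  then show ?thesis using nz[OF z] by (simp add: norm_divide)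
qed

text \<open>Inside the disk the factor z^m makes the right side strictly smaller in modulus. The
  equation is invariant under the reflection z -> 1 / conj z, which excludes solutions outside as
  well.\<close>

lemma self_inversive_roots:
  assumes Q: "\<And>z. norm z < R \<Longrightarrow> poly Q z \<noteq> 0" and R: "R > 1" and m: "0 < m"
    and root: "poly Q z = z ^ m * poly (conj_reflect Q) z"
  shows "norm z = 1"
proof -
  have no_inner: "norm z \<ge> 1" if root: "poly Q z = z ^ m * poly (conj_reflect Q) z" for z
  proof (rule ccontr)
    assume "\<not> norm z \<ge> 1"
    then have z: "norm z < 1" by simp
    have "norm (poly Q z) = norm z ^ m * norm (poly (conj_reflect Q) z)"
      by (subst root) (simp add: norm_mult norm_power)
    also have "\<dots> \<le> norm z ^ m * norm (poly Q z)"
      using norm_conj_reflect_disk[OF Q R] z by (intro mult_left_mono) auto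
    also have "\<dots> < 1 * norm (poly Q z)"
      using Q[of z] z R m by (intro mult_strict_right_mono) (auto simp: power_less_one_iff)
    finally show False by simp
  qed
  have z0: "z \<noteq> 0" using no_inner[OF root] by auto
  define u where "u = inverse (cnj z)"
  have u0: "u \<noteq> 0" using z0 by (simp add: u_def)
  have zu: "z = inverse (cnj u)" by (simp add: u_def)
  have 1: "poly (conj_reflect Q) z = z ^ degree Q * cnj (poly Q u)"
    using poly_conj_reflect[OF z0] by (simp add: u_def)
  have 2: "poly (conj_reflect Q) u = u ^ degree Q * cnj (poly Q z)"
    using poly_conj_reflect[OF u0] by (simp add: zu)
  have "u ^ m * poly (conj_reflect Q) u = u ^ m * (u ^ degree Q * cnj (z ^ m * (z ^ degree Q * cnj (poly Q u))))"
    unfolding 2 root 1 ..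
  also have "\<dots> = (u * cnj z) ^ (m + degree Q) * poly Q u"
    by (simp add: power_add power_mult_distrib)
  also have "u * cnj z = 1" using z0 by (simp add: u_def)
  finally have "norm u \<ge> 1" by (intro no_inner) simp
  then have "norm z \<le> 1"
    using one_le_inverse_iff[of "norm z"] by (simp add: u_def norm_inverse)
  with no_inner[OF root] show ?thesis by simp
qed

text \<open>The error bound is uniform in \<open>N\<close>: only the exponent of z in the Blaschke
  product depends on \<open>N\<close>, and its energy bound does not see that exponent.\<close>

lemma SF_approx_log_deriv:
  assumes Q: "\<And>z. norm z < R \<Longrightarrow> poly Q z \<noteq> 0" and R: "R > 1" and N: "degree Q < N"
  obtains h where "h \<in> SF N" "(\<lambda>z. poly (pderiv Q) z / poly Q z - h z) \<in> bergman1"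
    "bergman1_norm (\<lambda>z. poly (pderiv Q) z / poly Q z - h z) \<le> pi / sqrt 3"
proof -
  define m where "m = N - degree Q"
  have m: "0 < m" "N = m + degree Q" using N by (auto simp: m_def)
  define q where "q = conj_reflect Q"
  define P where "P = Q - monom 1 m * q"
  have Q0: "coeff Q 0 \<noteq> 0" using Q[of 0] R by (simp add: poly_0_coeff_0)
  then have "degree q = degree Q" unfolding q_def by (rule degree_conj_reflect)
  moreover have "q \<noteq> 0"
    using Q0 by (auto simp: q_def conj_reflect_def map_poly_eq_0_iff)
  ultimately have "degree (monom 1 m * q) = N"
    using m by (simp add: degree_mult_eq degree_monom_eq)
  \<comment> \<open>The second term has the larger degree because m > 0; hence P has exactly N zeros
    with multiplicity.\<close>
  then have degP: "degree P = N"
    unfolding P_def diff_conv_add_uminus using N by (subst degree_add_eq_right) auto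
  obtain w where w: "smult (lead_coeff P) (\<Prod>i<N. [:- w i, 1:]) = P"
    using complex_poly_decompose'[of P] unfolding degP by blast
  have P_poly: "poly P z = poly Q z - z ^ m * poly q z" for z
    by (simp add: P_def poly_monom)
  have P_roots: "norm z = 1" if "poly P z = 0" for z
    using self_inversive_roots[OF Q R m(1), of z] that by (simp add: P_poly q_def)
  have w_circle: "norm (w j) = 1" if "j < N" for j
  proof (rule P_roots)
    have "poly (\<Prod>i<N. [:- w i, 1:]) (w j) = 0" using that by (auto simp: poly_prod)
    then show "poly P (w j) = 0" by (subst w[symmetric]) simp
  qed
  define h where "h z = (\<Sum>j<N. 1 / (z - w j))" for z
  have h: "h \<in> SF N" unfolding SF_def h_def[abs_def] using w_circle by auto
  define B where "B z = z ^ m * poly q z / poly Q z" for z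
  have B_hol: "B holomorphic_on ball 0 R"
    unfolding B_def[abs_def] using Q by (intro holomorphic_intros) auto
  have B_disk: "norm (B z) < 1" if "norm z < 1" for z
  proof -
    have "norm (poly q z) / norm (poly Q z) \<le> 1"
      using norm_conj_reflect_disk[OF Q R, of z] Q[of z] that R by (simp add: q_def)
    then have "norm (B z) \<le> norm z ^ m * 1"
      unfolding B_def by (simp add: norm_mult norm_divide norm_power mult_left_le times_divide_eq_right[symmetric] del: times_divide_eq_right)
    also have "\<dots> < 1" using that m by (simp add: power_less_one_iff)
    finally show ?thesis .
  qed
  have "disk_energy (\<lambda>z. deriv B z / (1 - B z)) \<le> ennreal (pi\<^sup>2 / 6)"
  proof (rule disk_energy_inner_log_deriv[OF B_hol R])
    show "B 0 = 0" using m by (simp add: B_def)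
    show "norm (B (circ t)) = 1" for t
      using Q[of "circ t"] R norm_conj_reflect_circle[of "circ t" Q]
      by (simp add: B_def q_def norm_mult norm_divide norm_power)
  qed (rule B_disk)
  moreover have eq: "poly (pderiv Q) z / poly Q z - h z = deriv B z / (1 - B z)" if "norm z < 1" for z
  proof -
    have Qz: "poly Q z \<noteq> 0" using Q[of z] that R by simp
    have B1: "1 - B z \<noteq> 0" using B_disk[OF that] by auto
    have ne: "z \<noteq> w j" if "j < N" for j using \<open>norm z < 1\<close> w_circle[OF that] by auto
    have "lead_coeff P \<noteq> 0" using degP N by auto
    \<comment> \<open>The logarithmic derivative of P is computed twice: here from its zeros, giving
      \<open>h\<close>, and below from the factorization P = Q (1 - B).\<close>
    have "poly (pderiv P) z / poly P z
        = poly (pderiv (\<Prod>i<N. [:- w i, 1:])) z / poly (\<Prod>i<N. [:- w i, 1:]) z"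
      by (subst (1 2) w[symmetric]) (use \<open>lead_coeff P \<noteq> 0\<close> in \<open>simp add: pderiv_smult\<close>)
    then have "poly (pderiv P) z / poly P z = h z"
      unfolding h_def by (simp only: log_deriv_prod_linear[OF ne])
    moreover have Pz: "poly P z = poly Q z * (1 - B z)"
      using Qz by (simp add: P_poly B_def field_simps)
    moreover have "poly (pderiv P) z = poly (pderiv Q) z * (1 - B z) - poly Q z * deriv B z"
    proof -
      have dB: "(B has_field_derivative deriv B z) (at z)"
        using holomorphic_derivI[OF B_hol, of z] that R by simp
      have "((\<lambda>z. poly Q z * (1 - B z)) has_field_derivative
          poly (pderiv Q) z * (1 - B z) - poly Q z * deriv B z) (at z)"
        using DERIV_mult[OF poly_DERIV[of Q z] DERIV_diff[OF DERIV_const[of 1] dB]]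
        by (simp add: algebra_simps)
      moreover have "((\<lambda>z. poly Q z * (1 - B z)) has_field_derivative poly (pderiv P) z) (at z)"
      proof (rule has_field_derivative_transform_within_open[OF poly_DERIV[of P z], of "ball 0 1"])
        show "poly P x = poly Q x * (1 - B x)" if "x \<in> ball 0 1" for x
          using Q[of x] that R by (simp add: P_poly B_def field_simps)
      qed (use that in auto)
      ultimately show ?thesis using DERIV_unique by blast
    qed
    ultimately have "h z = (poly (pderiv Q) z * (1 - B z) - poly Q z * deriv B z) / (poly Q z * (1 - B z))"
      by simp
    also have "\<dots> = poly (pderiv Q) z / poly Q z - deriv B z / (1 - B z)"
      using Qz B1 by (simp add: diff_divide_distrib)
    finally show ?thesis by simp
  qed
  \<comment> \<open>pi / sqrt 3 is the norm whose square is twice the energy bound pi^2 / 6.\<close>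
  ultimately have e: "disk_energy (\<lambda>z. poly (pderiv Q) z / poly Q z - h z) \<le> ennreal ((pi / sqrt 3)\<^sup>2 / 2)"
    by (subst disk_energy_cong[of _ "\<lambda>z. deriv B z / (1 - B z)"]) (auto simp: power_divide)
  have "(\<lambda>z. poly (pderiv Q) z / poly Q z - h z) holomorphic_on unit_disk"
    unfolding h_def
  proof (intro holomorphic_intros)
    show "poly Q z \<noteq> 0" if "z \<in> unit_disk" for z using Q[of z] that R by simp
    show "z - w j \<noteq> 0" if "j \<in> {..<N}" "z \<in> unit_disk" for j z using w_circle[of j] that by auto
  qed
  from bergman1_norm_le[OF this e] h that show ?thesis by simp
qed

text \<open>The weight is normalized so that the constant 1 has norm 1; uniform approximation on the
  disk therefore carries over with the same constant.\<close>

lemma bergman1_norm_le_sup: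
  assumes g: "g holomorphic_on unit_disk" and c: "0 \<le> c" "\<And>z. norm z < 1 \<Longrightarrow> norm (g z) \<le> c"
  shows "g \<in> bergman1" "bergman1_norm g \<le> c"
proof -
  have "disk_energy g \<le> (\<integral>\<^sup>+z. ennreal (c\<^sup>2) * (ennreal (norm z ^ (2 * 0) * (1 - (norm z)\<^sup>2)) * indicator unit_disk z) \<partial>m2)"
    unfolding disk_energy_def
  proof (intro nn_integral_mono)
    fix z :: complex
    show "ennreal ((norm (g z))\<^sup>2 * (1 - (norm z)\<^sup>2)) * indicator unit_disk z
        \<le> ennreal (c\<^sup>2) * (ennreal (norm z ^ (2 * 0) * (1 - (norm z)\<^sup>2)) * indicator unit_disk z)"
    proof (cases "z \<in> unit_disk")
      case True
      then have "(norm (g z))\<^sup>2 * (1 - (norm z)\<^sup>2) \<le> c\<^sup>2 * (1 - (norm z)\<^sup>2)"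
        using c by (intro mult_right_mono power_mono disk_weight_nonneg) auto
      then show ?thesis using True by (simp add: ennreal_mult'[symmetric] ennreal_leI)
    qed simp
  qed
  also have "\<dots> = ennreal (c\<^sup>2) * ennreal (1 / ((real 0 + 1) * (real 0 + 2)))"
    by (subst nn_integral_cmult, measurable) (subst nn_integral_disk_monomial, rule refl)
  also have "\<dots> = ennreal (c\<^sup>2 / 2)"
    by (subst ennreal_mult[symmetric]) auto
  finally have "disk_energy g \<le> ennreal (c\<^sup>2 / 2)" .
  with bergman1_norm_le[OF g] c show "g \<in> bergman1" "bergman1_norm g \<le> c" by blast+
qed

text \<open>The zero-free polynomials \<open>Q = (1 + F / n)\<^sup>n\<close>, with \<open>F' = p\<close>, have logarithmic derivative
  \<open>p / (1 + F / n)\<close>.\<close>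
lemma SF_approx_poly:
  fixes p :: "complex poly"
  assumes e: "e > 0"
  obtains N0 where "\<And>N. N \<ge> N0 \<Longrightarrow> \<exists>h\<in>SF N. (\<lambda>z. poly p z - h z) \<in> bergman1 \<and>
    bergman1_norm (\<lambda>z. poly p z - h z) \<le> pi / sqrt 3 + e"
proof -
  define F where "F = (\<Sum>i\<le>degree p. monom (coeff p i / of_nat (Suc i)) (Suc i))"
  have "pderiv F = (\<Sum>i\<le>degree p. pderiv (monom (coeff p i / of_nat (Suc i)) (Suc i)))"
    unfolding F_def using sum_comp_morphism[of pderiv, symmetric] by (simp add: pderiv_add o_def)
  also have "\<dots> = (\<Sum>i\<le>degree p. monom (coeff p i) i)"
    using of_nat_neq_0[where 'a = complex]
    by (intro sum.cong refl) (simp add: pderiv_monom del: of_nat_Suc)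
  finally have "pderiv F = (\<Sum>i\<le>degree p. monom (coeff p i) i)" .
  then have F: "pderiv F = p" by (simp add: poly_as_sum_of_monoms)
  \<comment> \<open>Bounds on the disk of radius 2 leave room for zero-freeness beyond the closed
    unit disk.\<close>
  have "\<exists>C. \<forall>z\<in>cball 0 2. norm (poly r z) \<le> C" for r :: "complex poly"
  proof -
    have "compact ((\<lambda>z. poly r z) ` cball 0 2)"
      by (intro compact_continuous_image continuous_intros compact_cball)
    then show ?thesis by (auto dest: compact_imp_bounded simp: bounded_iff)
  qed
  then obtain C1 C2 where C1: "\<And>z. z \<in> cball 0 2 \<Longrightarrow> norm (poly F z) \<le> C1"
    and C2: "\<And>z. z \<in> cball 0 2 \<Longrightarrow> norm (poly p z) \<le> C2" by metis
  have C_nonneg: "0 \<le> C1" "0 \<le> C2" using order_trans[OF norm_ge_zero C1[of 0]] order_trans[OF norm_ge_zero C2[of 0]] by auto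
  \<comment> \<open>The first summand keeps F / n below 1/2 in modulus, hence G away from 0. The
    second makes the error p F / (n G), bounded by 2 C1 C2 / n, at most \<open>e\<close>.\<close>
  obtain n :: nat where n: "real n > 2 * C1 + 2 * C1 * C2 / e" using reals_Archimedean2 by blast
  have n0: "0 < real n" "real n > 2 * C1" "2 * C1 * C2 / e < real n"
  proof -
    have "0 \<le> 2 * C1 * C2 / e" using C_nonneg e by simp
    then show "0 < real n" "real n > 2 * C1" "2 * C1 * C2 / e < real n"
      using n C_nonneg by linarith+
  qed
  have half: "norm (1 + poly F z / of_nat n) \<ge> 1 / 2" if "norm z < 2" for z
  proof -
    have "norm (poly F z / of_nat n) \<le> 1 / 2"
      using C1[of z] that n0 by (simp add: norm_divide field_simps)
    then show ?thesis using norm_triangle_ineq2[of 1 "- (poly F z / of_nat n)"] by simp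
  qed
  define G where "G = 1 + smult (1 / of_nat n) F"
  have G: "poly G z = 1 + poly F z / of_nat n" for z by (simp add: G_def)
  define Q where "Q = G ^ n"
  have G_nz: "poly G z \<noteq> 0" if "norm z < 2" for z using half[OF that] by (auto simp: G)
  have Q_nz: "poly Q z \<noteq> 0" if "norm z < 2" for z using G_nz[OF that] by (simp add: Q_def)
  have log_deriv: "poly (pderiv Q) z / poly Q z = poly p z / poly G z" if "norm z < 2" for z
  proof -
    obtain k where k: "n = Suc k" using n0 by (cases n) auto
    have "pderiv G = smult (1 / of_nat n) p" by (simp add: G_def pderiv_add pderiv_smult F)
    then have "pderiv Q = G ^ k * p"
      unfolding Q_def k pderiv_power_Suc using of_nat_neq_0[where 'a = complex, of k]
      by (simp add: k del: of_nat_Suc)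
    then show ?thesis using G_nz[OF that] by (simp add: Q_def k)
  qed
  define g where "g z = poly p z - poly (pderiv Q) z / poly Q z" for z
  have "g holomorphic_on unit_disk"
    unfolding g_def[abs_def] using Q_nz by (intro holomorphic_intros) auto
  moreover have "norm (g z) \<le> e" if "norm z < 1" for z
  proof -
    have z2: "norm z < 2" "z \<in> cball 0 2" using that by auto
    have "g z = poly p z * (poly F z / of_nat n) / poly G z"
      unfolding g_def log_deriv[OF z2(1)] using G_nz[OF z2(1)]
      by (simp add: field_simps) (simp add: G algebra_simps)
    then have "norm (g z) = norm (poly p z) * (norm (poly F z) / real n) / norm (poly G z)"
      by (simp add: norm_mult norm_divide)
    also have "\<dots> \<le> C2 * (C1 / real n) / (1 / 2)"
      using C1[OF z2(2)] C2[OF z2(2)] half[OF z2(1)] C_nonneg n0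
      by (intro frac_le mult_mono divide_right_mono mult_nonneg_nonneg) (auto simp: G)
    also have "\<dots> \<le> e" using n0 e by (simp add: field_simps)
    finally show ?thesis .
  qed
  ultimately have g: "g \<in> bergman1" "bergman1_norm g \<le> e"
    using bergman1_norm_le_sup[of g e] e by auto
  have "\<exists>h\<in>SF N. (\<lambda>z. poly p z - h z) \<in> bergman1 \<and> bergman1_norm (\<lambda>z. poly p z - h z) \<le> pi / sqrt 3 + e"
    if N: "N \<ge> Suc (degree Q)" for N
  proof -
    obtain h where h: "h \<in> SF N" "(\<lambda>z. poly (pderiv Q) z / poly Q z - h z) \<in> bergman1"
      "bergman1_norm (\<lambda>z. poly (pderiv Q) z / poly Q z - h z) \<le> pi / sqrt 3"
      using SF_approx_log_deriv[of 2 Q N] Q_nz N by auto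
    have "(\<lambda>z. poly p z - h z) = (\<lambda>z. g z + (poly (pderiv Q) z / poly Q z - h z))"
      by (auto simp: g_def)
    with bergman1_triangle[OF g(1) h(2)] g(2) h show ?thesis by (intro bexI[of _ h]) auto
  qed
  with that show ?thesis by blast
qed

subsection \<open>Lower bound\<close>

text \<open>A quarter of the squared distance of \<open>s\<close> from \<open>2 \<pi> \<int>\<close>.\<close>
definition sawtooth_sq :: "real \<Rightarrow> real" where
  "sawtooth_sq s = (arccos (cos s))\<^sup>2 / 4"

lemma sawtooth_sq_nonneg [simp]: "0 \<le> sawtooth_sq s"
  by (simp add: sawtooth_sq_def)

lemma continuous_on_sawtooth_sq [continuous_intros]:
  fixes g :: "'a :: t2_space \<Rightarrow> real"
  shows "continuous_on A g \<Longrightarrow> continuous_on A (\<lambda>x. sawtooth_sq (g x))"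
  unfolding sawtooth_sq_def by (intro continuous_intros) auto

lemma sawtooth_sq_eq: "\<bar>s\<bar> \<le> pi \<Longrightarrow> sawtooth_sq s = s\<^sup>2 / 4"
  unfolding sawtooth_sq_def by (cases "0 \<le> s") (auto simp: arccos_cos arccos_cos2)

text \<open>The distance to the lattice of multiples of 2 pi is at most the distance to its point
  0.\<close>

lemma sawtooth_sq_le: "sawtooth_sq s \<le> s\<^sup>2 / 4"
proof (cases "\<bar>s\<bar> \<le> pi")
  case True
  then show ?thesis by (simp add: sawtooth_sq_eq)
next
  case False
  have "arccos (cos s) \<le> \<bar>s\<bar>" "0 \<le> arccos (cos s)"
    using False arccos_ubound[of "cos s"] arccos_lbound[of "cos s"] by auto
  then have "(arccos (cos s))\<^sup>2 \<le> \<bar>s\<bar>\<^sup>2" by (intro power_mono)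
  then show ?thesis by (simp add: sawtooth_sq_def)
qed

text \<open>An antiderivative of a periodic function increases over each period by the integral over
  one period, here the integral of s^2 / 4 over [-pi, pi].\<close>

lemma sawtooth_sq_antiderivative:
  obtains \<Phi> where "\<And>s. (\<Phi> has_real_derivative sawtooth_sq s) (at s)"
    "\<And>s n. \<Phi> (s + 2 * pi * real n) = \<Phi> s + real n * (pi ^ 3 / 6)"
proof -
  have "isCont sawtooth_sq s" for s
    using continuous_on_sawtooth_sq[OF continuous_on_id, of UNIV]
    by (simp add: continuous_on_eq_continuous_at)
  then obtain \<Phi> where "\<forall>s. (\<Phi> has_vector_derivative sawtooth_sq s) (at s)"
    using einterval_antiderivative[of "-\<infinity>" \<infinity> sawtooth_sq] by auto
  then have D: "(\<Phi> has_real_derivative sawtooth_sq s) (at s)" for s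
    by (simp add: has_real_derivative_iff_has_vector_derivative)
  have "(sawtooth_sq has_integral \<Phi> pi - \<Phi> (- pi)) {-pi..pi}"
    by (rule fundamental_theorem_of_calculus)
       (use D in \<open>auto simp: has_real_derivative_iff_has_vector_derivative[symmetric]
          intro: has_field_derivative_at_within\<close>)
  moreover have "((\<lambda>s. s\<^sup>2 / 4) has_integral pi ^ 3 / 12 - (- pi) ^ 3 / 12) {-pi..pi}"
  proof (rule fundamental_theorem_of_calculus)
    fix s :: real
    have "((\<lambda>s. s ^ 3 / 12) has_real_derivative s\<^sup>2 / 4) (at s within {-pi..pi})"
      by (auto intro!: derivative_eq_intros simp: power2_eq_square)
    then show "((\<lambda>s. s ^ 3 / 12) has_vector_derivative s\<^sup>2 / 4) (at s within {-pi..pi})"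
      by (simp add: has_real_derivative_iff_has_vector_derivative)
  qed simp
  then have "(sawtooth_sq has_integral pi ^ 3 / 12 - (- pi) ^ 3 / 12) {-pi..pi}"
    by (rule has_integral_eq[rotated]) (auto simp: sawtooth_sq_eq)
  ultimately have "\<Phi> pi - \<Phi> (- pi) = pi ^ 3 / 12 - (- pi) ^ 3 / 12"
    by (rule has_integral_unique)
  then have base: "\<Phi> pi - \<Phi> (- pi) = pi ^ 3 / 6" by simp
  have "((\<lambda>s. \<Phi> (s + 2 * pi) - \<Phi> s) has_real_derivative sawtooth_sq (s + 2 * pi) * 1 - sawtooth_sq s) (at s)" for s
    by (intro DERIV_diff D DERIV_chain2[OF D]) (auto intro!: derivative_eq_intros)
  then have "((\<lambda>s. \<Phi> (s + 2 * pi) - \<Phi> s) has_real_derivative 0) (at s)" for s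
    by (simp add: sawtooth_sq_def)
  from DERIV_isconst_all[OF allI[OF this]]
  have const: "\<Phi> (s + 2 * pi) - \<Phi> s = \<Phi> (- pi + 2 * pi) - \<Phi> (- pi)" for s by blast
  have step: "\<Phi> (s + 2 * pi) = \<Phi> s + pi ^ 3 / 6" for s
    using base const[of s] by simp
  have "\<Phi> (s + 2 * pi * real n) = \<Phi> s + real n * (pi ^ 3 / 6)" for s n
  proof (induction n)
    case (Suc n)
    then show ?case using step[of "s + 2 * pi * real n"] by (simp add: algebra_simps)
  qed simp
  with D that show ?thesis by blast
qed

text \<open>The integral of \<open>sawtooth_sq (\<psi> t) * \<psi>' t\<close> depends only on the winding number, and
  \<open>sawtooth_sq\<close> is nonnegative, so an upper bound for \<open>\<psi>'\<close> suffices.\<close>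
lemma sawtooth_sq_integral_ge:
  assumes \<psi>: "\<And>t. (\<psi> has_real_derivative \<psi>' t) (at t)"
    and wind: "\<psi> 1 = \<psi> 0 + 2 * pi * real N"
    and bound: "\<And>t. \<psi>' t \<le> 2 * pi * L" and L: "0 < L"
    and I: "((\<lambda>t. sawtooth_sq (\<psi> t)) has_integral I) {0..1}"
  shows "pi\<^sup>2 / 12 * (real N / L) \<le> I"
proof -
  obtain \<Phi> where D: "\<And>s. (\<Phi> has_real_derivative sawtooth_sq s) (at s)"
    and per: "\<And>s n. \<Phi> (s + 2 * pi * real n) = \<Phi> s + real n * (pi ^ 3 / 6)"
    using sawtooth_sq_antiderivative by blast
  \<comment> \<open>The chain rule takes the place of a change of variables, so the phase may run
    backwards on parts of the interval.\<close>
  have "((\<lambda>t. sawtooth_sq (\<psi> t) * \<psi>' t) has_integral \<Phi> (\<psi> 1) - \<Phi> (\<psi> 0)) {0..1}"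
  proof (rule fundamental_theorem_of_calculus)
    fix t :: real
    have "((\<lambda>t. \<Phi> (\<psi> t)) has_real_derivative sawtooth_sq (\<psi> t) * \<psi>' t) (at t)"
      by (rule DERIV_chain2[OF D \<psi>])
    then show "((\<lambda>t. \<Phi> (\<psi> t)) has_vector_derivative sawtooth_sq (\<psi> t) * \<psi>' t) (at t within {0..1})"
      by (simp add: has_real_derivative_iff_has_vector_derivative has_vector_derivative_at_within)
  qed simp
  moreover have "((\<lambda>t. sawtooth_sq (\<psi> t) * (2 * pi * L)) has_integral I * (2 * pi * L)) {0..1}"
    using I by (rule has_integral_mult_left)
  ultimately have "\<Phi> (\<psi> 1) - \<Phi> (\<psi> 0) \<le> I * (2 * pi * L)"
    by (rule has_integral_le) (intro mult_left_mono bound sawtooth_sq_nonneg)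
  then have "real N * (pi ^ 3 / 6) \<le> I * (2 * pi * L)"
    by (simp add: wind per)
  then have "(2 * pi) * (pi\<^sup>2 / 12 * real N) \<le> (2 * pi) * (I * L)"
    by (simp add: power2_eq_square power3_eq_cube mult_ac)
  then have "pi\<^sup>2 / 12 * real N \<le> I * L"
    by (rule mult_left_le_imp_le) simp
  then show ?thesis using L by (simp add: pos_divide_le_eq)
qed

section \<open>Boundary phase of the logarithms and the tail of the power sums\<close>

lemma exp_Im_Ln:
  assumes "x \<noteq> 0"
  shows "cis (2 * Im (Ln x)) = x / cnj x"
proof -
  have "cis (2 * Im (Ln x)) = exp (Ln x - cnj (Ln x))"
    by (simp add: cis_conv_exp complex_diff_cnj mult_ac)
  also have "\<dots> = x / cnj x"
    using assms by (simp add: exp_diff exp_cnj[symmetric])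
  finally show ?thesis .
qed

text \<open>On the circle 1 - u = - u conj (1 - u), so twice the argument of 1 - u is that of - u.
  This makes the phase of a sum of such logarithms linear in the angle modulo 2 pi.\<close>

lemma cis_Im_Ln_circle:
  assumes "norm u = 1" "u \<noteq> 1"
  shows "cis (2 * Im (Ln (1 - u))) = - u"
proof -
  have "u * cnj u = 1" using complex_norm_square[of u] assms(1) by simp
  then have "- u * cnj (1 - u) = 1 - u" by (simp add: algebra_simps)
  moreover have "cnj (1 - u) \<noteq> 0" using assms(2) by simp
  ultimately have "(1 - u) / cnj (1 - u) = - u" by (simp add: divide_eq_eq)
  then show ?thesis using exp_Im_Ln[of "1 - u"] assms(2) by simp
qed

text \<open>The closed disk of radius 1 about 1 meets the branch cut of the logarithm only at
  0.\<close>

lemma one_minus_circle_nonpos: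
  fixes u :: complex
  assumes "norm u \<le> 1" "u \<noteq> 1"
  shows "1 - u \<notin> \<real>\<^sub>\<le>\<^sub>0"
proof
  assume "1 - u \<in> \<real>\<^sub>\<le>\<^sub>0"
  then have "Re u \<ge> 1" "Im u = 0" by (auto simp: complex_nonpos_Reals_iff)
  moreover have "Re u \<le> 1" using complex_Re_le_cmod[of u] assms by simp
  ultimately show False using assms(2) by (simp add: complex_eq_iff)
qed

lemma mult_cnj_circle_eq_1:
  assumes "norm w = 1" "u * cnj w = 1"
  shows "u = w"
proof -
  have "u = u * (w * cnj w)" using complex_norm_square[of w] assms(1) by simp
  also have "\<dots> = (u * cnj w) * w" by (simp only: mult_ac)
  finally show ?thesis using assms(2) by simp
qed

text \<open>The poles on the circle are met only on a null set of parameters, which can be left out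
  of the integrals.\<close>

lemma countable_circ_eq: "countable {t. circ t = x}"
proof -
  have "\<exists>k :: int. t = (Arg x + 2 * pi * k) / (2 * pi)" if "circ t = x" for t
  proof -
    have "cis (2 * pi * t) = cis (Arg x)"
      using that cis_Arg[of x] norm_circ[of t] by (force simp: circ_def sgn_eq)
    then have "sin (2 * pi * t) = sin (Arg x) \<and> cos (2 * pi * t) = cos (Arg x)"
      by (simp add: complex_eq_iff)
    then obtain k where "2 * pi * t = Arg x + 2 * pi * of_int k"
      using sin_cos_eq_iff by auto
    then show ?thesis by (intro exI[of _ k]) (simp add: field_simps)
  qed
  then have "{t. circ t = x} \<subseteq> range (\<lambda>k :: int. (Arg x + 2 * pi * k) / (2 * pi))" by blast
  then show ?thesis by (rule countable_subset) simp
qed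

text \<open>Half of the tail sum bounds the mean square of \<open>Im V\<close> on smaller circles,
  and Fatou's lemma transfers this to the sawtooth of the boundary phase. The low power sums enter
  only through the speed of that phase, which is at most 2 pi times the denominator.\<close>

lemma power_sum_tail_ge:
  fixes w :: "nat \<Rightarrow> complex" and K :: nat
  assumes w: "\<And>j. j < N \<Longrightarrow> norm (w j) = 1" and N: "0 < N"
  defines "q \<equiv> \<lambda>k. \<Sum>j<N. cnj (w j) ^ k"
  shows "summable (\<lambda>n. if n \<le> K then 0 else (norm (q n))\<^sup>2 / (real n)\<^sup>2)" (is "summable ?v2")
    and "pi\<^sup>2 / 6 * (real N / (real N + 2 * (\<Sum>k=1..K. norm (q k))))
      \<le> (\<Sum>n. if n \<le> K then 0 else (norm (q n))\<^sup>2 / (real n)\<^sup>2)"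
proof -
  \<comment> \<open>These are the Taylor coefficients of \<open>V\<close>; the index 0 always falls
    in the first case.\<close>
  define v where "v n = (if n \<le> K then 0 else - q n / of_nat n)" for n
  define H where "H z = (\<Sum>j<N. Ln (1 - z * cnj (w j)))" for z
  define T where "T z = (\<Sum>k=1..K. - q k / of_nat k * z ^ k)" for z
  define V where "V z = H z - T z" for z
  define Q where "Q = (\<Sum>k=1..K. norm (q k))"
  have v2: "?v2 = (\<lambda>n. (norm (v n))\<^sup>2)"
    by (auto simp: v_def norm_divide power_divide)
  have qN: "norm (q n) \<le> real N" for n
  proof -
    have "norm (q n) \<le> (\<Sum>j<N. norm (cnj (w j) ^ n))"
      unfolding q_def by (rule norm_sum)
    also have "\<dots> = (\<Sum>j<N. 1)" by (intro sum.cong refl) (simp add: norm_power w)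
    finally show ?thesis by simp
  qed
  have summ: "summable (\<lambda>n. (norm (v n))\<^sup>2)"
  proof (rule summable_comparison_test')
    show "summable (\<lambda>n. (real N)\<^sup>2 * inverse ((real n)\<^sup>2))"
      by (intro summable_mult inverse_power_summable) simp
    show "norm ((norm (v n))\<^sup>2) \<le> (real N)\<^sup>2 * inverse ((real n)\<^sup>2)" for n
      using power_mono[OF qN[of n], of 2]
      by (auto simp: v_def norm_divide power_divide divide_inverse[symmetric] intro!: divide_right_mono)
  qed
  then show "summable ?v2" unfolding v2 .
  define S where "S = (\<Sum>n. (norm (v n))\<^sup>2)"
  have S: "(\<Sum>n. ?v2 n) = S" unfolding S_def v2 ..
  have Vs: "(\<lambda>n. v n * z ^ n) sums V z" if "norm z < 1" for z
  proof -
    have "(\<lambda>n. - ((z * cnj (w j)) ^ n) / of_nat n) sums Ln (1 - z * cnj (w j))" if "j < N" for j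
      using Ln_series'[of "- (z * cnj (w j))"] w[OF that] \<open>norm z < 1\<close> by (simp add: norm_mult)
    then have "(\<lambda>n. \<Sum>j<N. - ((z * cnj (w j)) ^ n) / of_nat n) sums H z"
      unfolding H_def by (intro sums_sum) auto
    moreover have "(\<Sum>j<N. - ((z * cnj (w j)) ^ n) / of_nat n) = - q n / of_nat n * z ^ n" for n
      by (simp add: q_def power_mult_distrib sum_divide_distrib sum_distrib_left sum_negf mult_ac)
    ultimately have 1: "(\<lambda>n. - q n / of_nat n * z ^ n) sums H z" by simp
    have 2: "(\<lambda>n. if n \<in> {1..K} then - q n / of_nat n * z ^ n else 0) sums T z"
      unfolding T_def by (rule sums_If_finite_set) simp
    \<comment> \<open>The index 0 is not in \<open>{1..K}\<close>, but division by 0 yields 0, which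
      is the constant coefficient of the logarithms.\<close>
    have "- q n / of_nat n * z ^ n - (if n \<in> {1..K} then - q n / of_nat n * z ^ n else 0) = v n * z ^ n" for n
      by (cases n) (auto simp: v_def)
    with sums_diff[OF 1 2] show ?thesis by (simp add: V_def)
  qed
  have Vhol: "V holomorphic_on ball 0 1"
  proof -
    have "1 - z * cnj (w j) \<notin> \<real>\<^sub>\<le>\<^sub>0" if "j < N" "norm z < 1" for j z
      using that w[OF that(1)] by (intro one_minus_circle_nonpos) (auto simp: norm_mult dest: arg_cong[of _ _ norm])
    then show ?thesis
      unfolding V_def[abs_def] H_def T_def by (intro holomorphic_intros) auto
  qed
  have V0: "V 0 = 0" by (simp add: V_def H_def T_def power_0_left)
  have inner: "(\<integral>\<^sup>+t. ennreal ((Im (V (of_real r * circ t)))\<^sup>2) * indicator {0..1} t \<partial>lborel) \<le> ennreal (S / 2)"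
    if r: "0 < r" "r < 1" for r
  proof -
    let ?V = "\<lambda>z. V (of_real r * z)"
    \<comment> \<open>V^2 vanishes at the origin and so has mean zero; hence the mean of |V|^2 is
      twice the mean of (Im V)^2.\<close>
    have "(\<lambda>z. (?V z)\<^sup>2) holomorphic_on ball 0 (1 / r)"
      by (intro holomorphic_intros holomorphic_on_compose_gen[OF _ Vhol, unfolded o_def])
         (use r in \<open>auto simp: norm_mult field_simps\<close>)
    from mean_value_circle[OF this] have m: "((\<lambda>t. (?V (circ t))\<^sup>2) has_integral 0) {0..1}"
      using r V0 by simp
    have s: "summable (\<lambda>n. norm (v n * of_real r ^ n))"
      by (rule power_series_abs_summable[of 1 v V]) (use Vs r in auto)
    have eq: "(\<Sum>n. v n * of_real r ^ n * circ t ^ n) = ?V (circ t)" for t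
      using Vs[of "of_real r * circ t"] r by (simp add: sums_iff norm_mult power_mult_distrib mult_ac)
    define P where "P = (\<Sum>n. (norm (v n * of_real r ^ n))\<^sup>2)"
    have "((\<lambda>t. (norm (?V (circ t)))\<^sup>2) has_integral P) {0..1}"
      using parseval(1)[OF s] unfolding eq P_def .
    from has_integral_divide[OF has_integral_diff[OF this has_integral_Re[OF m]], of 2]
    have "((\<lambda>t. ((norm (?V (circ t)))\<^sup>2 - Re ((?V (circ t))\<^sup>2)) / 2) has_integral P / 2) {0..1}"
      by simp
    moreover have "((norm z)\<^sup>2 - Re (z\<^sup>2)) / 2 = (Im z)\<^sup>2" for z
      using cmod_power2[of z] by (simp add: power2_eq_square)
    ultimately have "((\<lambda>t. (Im (?V (circ t)))\<^sup>2) has_integral P / 2) {0..1}" by simp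
    then have "(\<integral>\<^sup>+t. ennreal ((Im (?V (circ t)))\<^sup>2) * indicator {0..1} t \<partial>lborel) = ennreal (P / 2)"
      by (intro nn_integral_has_integral_lebesgue') auto
    moreover have "P \<le> S"
      unfolding P_def S_def
    proof (intro suminf_le parseval(2)[OF s] summ)
      show "(norm (v n * of_real r ^ n))\<^sup>2 \<le> (norm (v n))\<^sup>2" for n
        using r by (intro power_mono) (auto simp: norm_mult norm_power mult_left_le power_le_one)
    qed
    ultimately show ?thesis by (simp add: ennreal_leI)
  qed
  \<comment> \<open>By \<open>cis_Im_Ln_circle\<close> each logarithm contributes the phase - z conj
    (w j); \<open>C\<close> collects the factors independent of z.\<close>
  define C where "C = (\<Prod>j<N. - cnj (w j))"
  have "norm C = 1" unfolding C_def by (simp add: prod_norm[symmetric] w)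
  moreover from this have "C \<noteq> 0" by auto
  ultimately have C: "cis (Arg C) = C" by (simp add: cis_Arg sgn_eq)
  \<comment> \<open>A smooth phase that is congruent to \<open>2 * Im V\<close> modulo 2 pi, whereas
    \<open>Im V\<close> itself need not be continuous at the points \<open>w j\<close>.\<close>
  define \<psi> where "\<psi> t = 2 * pi * real N * t + Arg C - 2 * Im (T (circ t))" for t
  have phase: "cos (2 * Im (V (circ t))) = cos (\<psi> t)" if circ_ne: "\<And>j. j < N \<Longrightarrow> circ t \<noteq> w j" for t
  proof -
    have ne: "circ t * cnj (w j) \<noteq> 1" if "j < N" for j
      using mult_cnj_circle_eq_1[OF w[OF that]] circ_ne[OF that] by blast
    have "cis (2 * Im (H (circ t))) = (\<Prod>j<N. cis (2 * Im (Ln (1 - circ t * cnj (w j)))))"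
      unfolding H_def by (simp add: cis_conv_exp exp_sum[symmetric] sum_distrib_left Im_sum)
    also have "\<dots> = (\<Prod>j<N. circ t * - cnj (w j))"
      by (intro prod.cong refl) (simp add: cis_Im_Ln_circle ne norm_mult w)
    also have "\<dots> = circ t ^ N * C"
      by (simp only: C_def prod.distrib prod_constant card_lessThan)
    also have "\<dots> = cis (2 * pi * real N * t + Arg C)"
      by (subst C[symmetric]) (simp only: circ_power cis_mult)
    finally have "cis (2 * Im (H (circ t))) = cis (2 * pi * real N * t + Arg C)" .
    then have "cis (2 * Im (H (circ t))) * cis (- 2 * Im (T (circ t)))
        = cis (2 * pi * real N * t + Arg C) * cis (- 2 * Im (T (circ t)))" by simp
    then have "cis (2 * Im (V (circ t))) = cis (\<psi> t)"
      by (simp add: cis_mult V_def \<psi>_def algebra_simps)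
    from arg_cong[OF this, of Re] show ?thesis by simp
  qed
  have contT: "continuous_on {0..1} (\<lambda>t. T (circ t))"
    unfolding T_def by (intro continuous_intros) auto
  have "continuous_on {0..1} (\<lambda>t. sawtooth_sq (\<psi> t))"
    unfolding \<psi>_def by (intro continuous_intros contT)
  then obtain I where I: "((\<lambda>t. sawtooth_sq (\<psi> t)) has_integral I) {0..1}"
    using integrable_continuous_real[of 0 1] by blast
  have "I \<le> S / 2"
  proof -
    \<comment> \<open>Boundary values are reached along radii: V converges radially except at the
      poles, and the bound \<open>inner\<close> holds on every smaller circle.\<close>
    define r where "r n = 1 - 1 / (real n + 2)" for n
    have r: "0 < r n" "r n < 1" for n by (auto simp: r_def field_simps)
    have rlim: "r \<longlonglongrightarrow> 1" unfolding r_def by real_asymp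
    define f where "f n t = ennreal ((Im (V (of_real (r n) * circ t)))\<^sup>2) * indicator {0..1} t" for n t
    have cV: "continuous_on UNIV (\<lambda>t. V (of_real (r n) * circ t))" for n
      by (rule continuous_on_compose2[OF holomorphic_on_imp_continuous_on[OF Vhol]])
         (use r[of n] in \<open>auto intro!: continuous_intros simp: norm_mult\<close>)
    have [measurable]: "f n \<in> borel_measurable lborel" for n
    proof -
      have [measurable]: "(\<lambda>t. V (of_real (r n) * circ t)) \<in> borel_measurable borel"
        by (rule borel_measurable_continuous_onI[OF cV])
      show ?thesis unfolding f_def[abs_def] by measurable
    qed
    define X where "X = (\<Union>j<N. {t. circ t = w j})"
    have "X \<in> null_sets lborel"
      unfolding X_def by (intro countable_imp_null_set_lborel countable_UN countable_circ_eq) auto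
    then have ae: "AE t in lborel. t \<notin> X" by (rule AE_not_in)
    have pw: "ennreal (sawtooth_sq (\<psi> t)) * indicator {0..1} t \<le> liminf (\<lambda>n. f n t)" if "t \<notin> X" for t
    proof -
      have tw: "circ t \<noteq> w j" if "j < N" for j using that \<open>t \<notin> X\<close> by (auto simp: X_def)
      have nonpos: "1 - circ t * cnj (w j) \<notin> \<real>\<^sub>\<le>\<^sub>0" if "j < N" for j
      proof (rule one_minus_circle_nonpos)
        show "circ t * cnj (w j) \<noteq> 1"
          using mult_cnj_circle_eq_1[OF w[OF that]] tw[OF that] by blast
      qed (simp add: norm_mult w[OF that])
      have "isCont V (circ t)"
        unfolding V_def[abs_def] H_def T_def using nonpos by (intro continuous_intros) auto
      moreover have "(\<lambda>n. of_real (r n) * circ t) \<longlonglongrightarrow> circ t"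
        using tendsto_mult[OF tendsto_of_real[OF rlim, where 'a = complex] tendsto_const[of "circ t"]] by simp
      ultimately have "(\<lambda>n. V (of_real (r n) * circ t)) \<longlonglongrightarrow> V (circ t)"
        by (rule isCont_tendsto_compose)
      then have "(\<lambda>n. (Im (V (of_real (r n) * circ t)))\<^sup>2) \<longlonglongrightarrow> (Im (V (circ t)))\<^sup>2"
        by (intro tendsto_intros)
      then have "(\<lambda>n. f n t) \<longlonglongrightarrow> ennreal ((Im (V (circ t)))\<^sup>2) * indicator {0..1} t"
        unfolding f_def by (cases "t \<in> {0..1}") (auto intro!: tendsto_ennrealI)
      then have "liminf (\<lambda>n. f n t) = ennreal ((Im (V (circ t)))\<^sup>2) * indicator {0..1} t"
        by (intro lim_imp_Liminf) auto
      moreover have "sawtooth_sq (\<psi> t) \<le> (Im (V (circ t)))\<^sup>2"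
      proof -
        have "sawtooth_sq (\<psi> t) = sawtooth_sq (2 * Im (V (circ t)))"
          using phase[OF tw] by (simp add: sawtooth_sq_def)
        also have "\<dots> \<le> (2 * Im (V (circ t)))\<^sup>2 / 4" by (rule sawtooth_sq_le)
        finally show ?thesis by simp
      qed
      ultimately show ?thesis by (auto intro: ennreal_leI mult_right_mono)
    qed
    have "ennreal I = (\<integral>\<^sup>+t. ennreal (sawtooth_sq (\<psi> t)) * indicator {0..1} t \<partial>lborel)"
      by (rule nn_integral_has_integral_lebesgue'[OF _ I, symmetric]) simp
    also have "\<dots> \<le> (\<integral>\<^sup>+t. liminf (\<lambda>n. f n t) \<partial>lborel)"
      by (rule nn_integral_mono_AE) (use ae pw in auto)
    also have "\<dots> \<le> liminf (\<lambda>n. \<integral>\<^sup>+t. f n t \<partial>lborel)"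
      by (rule nn_integral_liminf) simp
    also have "\<dots> \<le> ennreal (S / 2)"
      by (rule Liminf_le) (use inner r in \<open>auto simp: f_def\<close>)
    finally show ?thesis
      using suminf_nonneg[OF summ] by (simp add: S_def ennreal_le_iff)
  qed
  moreover have "pi\<^sup>2 / 12 * (real N / (real N + 2 * Q)) \<le> I"
  proof (rule sawtooth_sq_integral_ge[OF _ _ _ _ I])
    define T' where "T' t = (\<Sum>k=1..K. - q k / of_nat k * ((2 * pi * real k) *\<^sub>R (\<i> * circ (real k * t))))" for t
    have T_circ: "T (circ t) = (\<Sum>k=1..K. - q k / of_nat k * circ (real k * t))" for t
      unfolding T_def by (intro sum.cong refl) (simp add: circ_power, simp add: circ_def mult_ac)
    have VT: "((\<lambda>t. T (circ t)) has_vector_derivative T' t) (at t)" for t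
      unfolding T_circ T'_def
      by (intro has_vector_derivative_sum has_vector_derivative_mult_right circ_has_vector_derivative)
    have ImT: "((\<lambda>t. Im (T (circ t))) has_real_derivative Im (T' t)) (at t)" for t
      unfolding has_real_derivative_iff_has_vector_derivative
      by (rule bounded_linear.has_vector_derivative[OF bounded_linear_Im VT])
    show "(\<psi> has_real_derivative 2 * pi * real N - 2 * Im (T' t)) (at t)" for t
      using DERIV_diff[OF DERIV_add[OF DERIV_cmult[OF DERIV_ident, of "2 * pi * real N"]
            DERIV_const[of "Arg C"]] DERIV_cmult[OF ImT[of t], of 2]]
      by (simp add: \<psi>_def[abs_def])
    have T'_le: "norm (T' t) \<le> 2 * pi * Q" for t
    proof -
      have "norm (T' t) \<le> (\<Sum>k=1..K. norm (- q k / of_nat k * ((2 * pi * real k) *\<^sub>R (\<i> * circ (real k * t)))))"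
        unfolding T'_def by (rule norm_sum)
      \<comment> \<open>The factor k from differentiation cancels the 1 / k in the coefficients of
        \<open>T\<close>.\<close>
      also have "\<dots> = (\<Sum>k=1..K. 2 * pi * norm (q k))"
        by (intro sum.cong refl) (auto simp: norm_mult norm_divide)
      finally show ?thesis by (simp add: Q_def sum_distrib_left)
    qed
    show "2 * pi * real N - 2 * Im (T' t) \<le> 2 * pi * (real N + 2 * Q)" for t
      using abs_Im_le_cmod[of "T' t"] T'_le[of t] by (simp add: algebra_simps)
    \<comment> \<open>\<open>T\<close> is single-valued on the circle, so it does not change the
      winding number.\<close>
    show "\<psi> 1 = \<psi> 0 + 2 * pi * real N" by (simp add: \<psi>_def circ_def)
    show "0 < real N + 2 * Q" using N by (simp add: Q_def add_pos_nonneg sum_nonneg)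
  qed
  ultimately have "2 * (pi\<^sup>2 / 12 * (real N / (real N + 2 * Q))) \<le> S" by linarith
  moreover have "pi\<^sup>2 / 6 * x = 2 * (pi\<^sup>2 / 12 * x)" for x by simp
  ultimately show "pi\<^sup>2 / 6 * (real N / (real N + 2 * (\<Sum>k=1..K. norm (q k)))) \<le> (\<Sum>n. ?v2 n)"
    unfolding S Q_def[symmetric] by (simp only:)
qed

subsection \<open>The limit of the distances\<close>

lemma inverse_linear_product_summable:
  "summable (\<lambda>n. 1 / ((real n + 1) * (real n + 2)))"
proof (rule summable_comparison_test')
  show "summable (\<lambda>n. 1 / (real n + 1)\<^sup>2)"
    using inverse_squares_sums by (auto simp: sums_iff add.commute)
  show "norm (1 / ((real n + 1) * (real n + 2))) \<le> 1 / (real n + 1)\<^sup>2" for n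
    by (auto simp: power2_eq_square intro!: divide_left_mono mult_left_mono)
qed

text \<open>Factoring out - 1 / w = - conj w leaves a geometric series.\<close>

lemma inverse_linear_sums:
  assumes w: "norm w = 1" and z: "norm z < 1"
  shows "(\<lambda>n. - (cnj w ^ Suc n) * z ^ n) sums (1 / (z - w))"
proof -
  have ww: "cnj w * w = 1" using complex_norm_square[of w] w by (simp add: mult.commute)
  have "(\<lambda>n. (cnj w * z) ^ n) sums (1 / (1 - cnj w * z))"
    by (rule geometric_sums) (use w z in \<open>simp add: norm_mult\<close>)
  then have "(\<lambda>n. - cnj w * (cnj w * z) ^ n) sums (- cnj w * (1 / (1 - cnj w * z)))"
    by (rule sums_mult)
  moreover have "- cnj w * (1 / (1 - cnj w * z)) = 1 / (z - w)"
  proof -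
    have eq: "1 - cnj w * z = - (cnj w * (z - w))" using ww by (simp add: algebra_simps)
    have "z \<noteq> w" "cnj w \<noteq> 0" using w z by auto
    then show ?thesis unfolding eq by simp
  qed
  ultimately show ?thesis by (simp add: power_mult_distrib mult_ac)
qed

lemma SF_power_series:
  assumes "\<And>j. j < N \<Longrightarrow> norm (w j) = 1" "norm z < 1"
  shows "(\<lambda>n. - (\<Sum>j<N. cnj (w j) ^ Suc n) * z ^ n) sums (\<Sum>j<N. 1 / (z - w j))"
proof -
  have "(\<lambda>n. \<Sum>j<N. - (cnj (w j) ^ Suc n) * z ^ n) sums (\<Sum>j<N. 1 / (z - w j))"
    by (intro sums_sum inverse_linear_sums) (use assms in auto)
  then show ?thesis by (simp add: sum_distrib_right sum_negf)
qed

lemma SF_holomorphic: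
  assumes "\<And>j. j < N \<Longrightarrow> norm (w j) = 1"
  shows "(\<lambda>z. \<Sum>j<N. 1 / (z - w j)) holomorphic_on unit_disk"
proof (intro holomorphic_intros)
  show "z - w j \<noteq> 0" if "j \<in> {..<N}" "z \<in> unit_disk" for j z using assms[of j] that by auto
qed

lemma SF_I:
  assumes "\<And>j. j < N \<Longrightarrow> norm (w j) = 1"
  shows "(\<lambda>z. \<Sum>j<N. 1 / (z - w j)) \<in> SF N"
  unfolding SF_def using assms by (intro CollectI exI[of _ w]) simp

lemma SF_E:
  assumes "h \<in> SF N"
  obtains w where "h = (\<lambda>z. \<Sum>j<N. 1 / (z - w j))" "\<And>j. j < N \<Longrightarrow> norm (w j) = 1"
  using assms unfolding SF_def by auto

lemma SF_bergman1:
  assumes "h \<in> SF N"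
  shows "h \<in> bergman1"
proof -
  obtain w where h: "h = (\<lambda>z. \<Sum>j<N. 1 / (z - w j))" and w: "\<And>j. j < N \<Longrightarrow> norm (w j) = 1"
    using SF_E[OF assms] by blast
  have hol: "h holomorphic_on unit_disk" unfolding h by (rule SF_holomorphic[OF w])
  have "disk_energy h = (\<Sum>n. ennreal ((norm (- (\<Sum>j<N. cnj (w j) ^ Suc n)))\<^sup>2 / ((real n + 1) * (real n + 2))))"
    by (rule disk_energy_power_series[OF hol]) (unfold h, rule SF_power_series[OF w], simp_all)
  also have "\<dots> \<le> (\<Sum>n. ennreal ((real N)\<^sup>2 * (1 / ((real n + 1) * (real n + 2)))))"
  proof (intro suminf_le ennreal_leI)
    fix n
    have "norm (\<Sum>j<N. cnj (w j) ^ Suc n) \<le> (\<Sum>j<N. norm (cnj (w j) ^ Suc n))" by (rule norm_sum)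
    also have "\<dots> = real N" using w by (simp add: norm_mult norm_power)
    finally have "(norm (\<Sum>j<N. cnj (w j) ^ Suc n))\<^sup>2 \<le> (real N)\<^sup>2" by (intro power_mono) auto
    then show "(norm (- (\<Sum>j<N. cnj (w j) ^ Suc n)))\<^sup>2 / ((real n + 1) * (real n + 2))
        \<le> (real N)\<^sup>2 * (1 / ((real n + 1) * (real n + 2)))"
      by (simp add: divide_right_mono del: power_Suc)
  qed auto
  also have "\<dots> = ennreal (\<Sum>n. (real N)\<^sup>2 * (1 / ((real n + 1) * (real n + 2))))"
    by (intro suminf_ennreal2 summable_mult inverse_linear_product_summable) simp
  finally have "disk_energy h < \<infinity>" by (auto intro: le_less_trans)
  with hol show ?thesis by (simp add: bergman1_iff)
qed

text \<open>Taylor polynomials suffice: the energy of the remainder is a tail of the convergent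
  coefficient series.\<close>

lemma bergman1_poly_dense:
  assumes f: "f \<in> bergman1" and e: "e > 0"
  obtains p :: "complex poly" where "(\<lambda>z. f z - poly p z) \<in> bergman1"
    "bergman1_norm (\<lambda>z. f z - poly p z) \<le> e"
proof -
  have hol: "f holomorphic_on unit_disk" and fin: "disk_energy f < \<infinity>"
    using f by (auto simp: bergman1_iff)
  define a where "a n = (deriv ^^ n) f 0 / fact n" for n
  have a: "(\<lambda>n. a n * z ^ n) sums f z" if "z \<in> unit_disk" for z
    using holomorphic_power_series[OF hol that] by (simp add: a_def)
  define s where "s n = (norm (a n))\<^sup>2 / ((real n + 1) * (real n + 2))" for n
  have s0: "0 \<le> s n" for n by (simp add: s_def)
  have "disk_energy f = (\<Sum>n. ennreal (s n))"
    unfolding s_def by (rule disk_energy_power_series[OF hol a])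
  with fin have s: "summable s" using summable_suminf_not_top[of s] s0 by auto
  have "0 < e\<^sup>2 / 2" using e by simp
  from suminf_exist_split[OF this s] obtain M where M: "norm (\<Sum>i. s (i + M)) < e\<^sup>2 / 2" by blast
  define p where "p = (\<Sum>n<M. monom (a n) n)"
  define b where "b n = (if n < M then 0 else a n)" for n
  have hol': "(\<lambda>z. f z - poly p z) holomorphic_on unit_disk"
    by (intro holomorphic_intros hol)
  have "(\<lambda>n. b n * z ^ n) sums (f z - poly p z)" if "z \<in> unit_disk" for z
  proof -
    have "(\<lambda>n. if n \<in> {..<M} then a n * z ^ n else 0) sums (\<Sum>n<M. a n * z ^ n)"
      by (rule sums_If_finite_set) simp
    from sums_diff[OF a[OF that] this]
    have "(\<lambda>n. a n * z ^ n - (if n \<in> {..<M} then a n * z ^ n else 0)) sums (f z - poly p z)"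
      by (simp add: p_def poly_sum poly_monom)
    moreover have "a n * z ^ n - (if n \<in> {..<M} then a n * z ^ n else 0) = b n * z ^ n" for n
      by (simp add: b_def)
    ultimately show ?thesis by simp
  qed
  then have "disk_energy (\<lambda>z. f z - poly p z) = (\<Sum>n. ennreal ((norm (b n))\<^sup>2 / ((real n + 1) * (real n + 2))))"
    by (rule disk_energy_power_series[OF hol'])
  also have "\<dots> = (\<Sum>n. ennreal (if n < M then 0 else s n))"
    by (intro suminf_cong) (simp add: b_def s_def)
  also have "\<dots> = ennreal (\<Sum>n. if n < M then 0 else s n)"
    by (intro suminf_ennreal2 summable_comparison_test'[OF s]) (auto simp: s0)
  also have "(\<Sum>n. if n < M then 0 else s n) = (\<Sum>i. s (i + M))"
  proof -
    have "summable (\<lambda>n. if n < M then 0 else s n)"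
      by (intro summable_comparison_test'[OF s]) (auto simp: s0)
    from suminf_split_initial_segment[OF this, of M] show ?thesis by simp
  qed
  also have "\<dots> \<le> e\<^sup>2 / 2" using M by simp
  finally have "disk_energy (\<lambda>z. f z - poly p z) \<le> ennreal (e\<^sup>2 / 2)" by (simp add: ennreal_leI)
  from bergman1_norm_le[OF hol' this] e that show ?thesis by simp
qed

lemma poly_bergman1: "poly p \<in> bergman1"
proof -
  have "bounded (poly p ` cball 0 1)"
    by (intro compact_imp_bounded compact_continuous_image continuous_intros compact_cball)
  then obtain C where "\<forall>z\<in>cball 0 1. norm (poly p z) \<le> C"
    unfolding bounded_iff by blast
  then show ?thesis
    using order_trans[OF norm_ge_zero, of "poly p 0" C]
    by (intro bergman1_norm_le_sup(1)[of _ C] holomorphic_intros) auto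
qed

text \<open>The first \<open>K\<close> coefficients of the difference bound the low power sums
  independently of \<open>N\<close>. From index \<open>K\<close> on, p contributes nothing and the
  coefficients are power sums, to which the tail estimate applies. The factor (K + 1) / (K + 2) is
  the least ratio, over n >= K, of the weights 1 / ((n + 1) (n + 2)) and 1 / (n + 1)^2.\<close>

lemma SF_dist_poly_ge:
  fixes p :: "complex poly" and K :: nat
  assumes w: "\<And>j. j < N \<Longrightarrow> norm (w j) = 1" and N: "0 < N" and K: "degree p < K"
    and D: "bergman1_norm (\<lambda>z. poly p z - (\<Sum>j<N. 1 / (z - w j))) \<le> c"
  shows "(real K + 1) / (real K + 2) * (pi\<^sup>2 / 3)
    * (real N / (real N + 2 * (\<Sum>k=1..K. norm (coeff p (k - 1)) + c * (real K + 1)))) \<le> c\<^sup>2"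
proof -
  define q where "q k = (\<Sum>j<N. cnj (w j) ^ k)" for k
  define g where "g z = poly p z - (\<Sum>j<N. 1 / (z - w j))" for z
  define s where "s n = (norm (coeff p n + q (Suc n)))\<^sup>2 / ((real n + 1) * (real n + 2))" for n
  have s0: "0 \<le> s n" for n by (simp add: s_def)
  have hol: "g holomorphic_on unit_disk"
    unfolding g_def[abs_def]
    by (rule holomorphic_on_diff[OF _ SF_holomorphic[OF w]]) (intro holomorphic_intros)
  have g: "g \<in> bergman1"
    unfolding g_def[abs_def] by (rule bergman1_diff(1)[OF poly_bergman1 SF_bergman1[OF SF_I[OF w]]])
  have c0: "0 \<le> c" using order_trans[OF bergman1_norm_nonneg D] .
  have "(\<lambda>n. (coeff p n + q (Suc n)) * z ^ n) sums g z" if "z \<in> unit_disk" for z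
  proof -
    have "(\<lambda>n. coeff p n * z ^ n) sums (\<Sum>n\<le>degree p. coeff p n * z ^ n)"
      by (rule sums_finite) (auto simp: coeff_eq_0)
    then have "(\<lambda>n. coeff p n * z ^ n) sums poly p z" by (simp add: poly_altdef)
    moreover have "(\<lambda>n. - q (Suc n) * z ^ n) sums (\<Sum>j<N. 1 / (z - w j))"
      unfolding q_def by (rule SF_power_series[OF w]) (use that in auto)
    ultimately have "(\<lambda>n. coeff p n * z ^ n - - q (Suc n) * z ^ n) sums g z"
      unfolding g_def by (rule sums_diff)
    then show ?thesis by (simp add: distrib_right)
  qed
  then have E: "disk_energy g = (\<Sum>n. ennreal (s n))"
    unfolding s_def by (rule disk_energy_power_series[OF hol])
  have "(\<Sum>n. ennreal (s n)) \<noteq> top"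
    using g unfolding bergman1_iff E by auto
  with s0 have s: "summable s" by (rule summable_suminf_not_top)
  have "ennreal (suminf s) = ennreal ((bergman1_norm g)\<^sup>2 / 2)"
    using E disk_energy_bergman1[OF g] s s0 by (simp add: suminf_ennreal2)
  then have "suminf s = (bergman1_norm g)\<^sup>2 / 2"
    using suminf_nonneg[OF s s0] by simp
  also have "\<dots> \<le> c\<^sup>2 / 2"
    using D by (intro divide_right_mono power_mono) (auto simp: g_def[abs_def])
  finally have sum_le: "suminf s \<le> c\<^sup>2 / 2" .
  \<comment> \<open>A single summand is at most the whole energy. The crude weight bound (K + 1)^2
    suffices because it does not involve \<open>N\<close>.\<close>
  have q_le: "norm (q k) \<le> norm (coeff p (k - 1)) + c * (real K + 1)" if k: "k \<in> {1..K}" for k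
  proof -
    obtain n where n: "k = Suc n" "n < K" using k by (cases k) auto
    have "s n \<le> suminf s"
      using sum_le_suminf[OF s, of "{n}"] s0 by simp
    also note sum_le
    finally have "(norm (coeff p n + q k))\<^sup>2 \<le> c\<^sup>2 / 2 * ((real n + 1) * (real n + 2))"
      unfolding s_def n(1) by (subst (asm) pos_divide_le_eq) simp_all
    also have "\<dots> \<le> c\<^sup>2 * ((real K + 1) * (real K + 1))"
      using n by (intro mult_mono) auto
    also have "\<dots> = (c * (real K + 1))\<^sup>2" by (simp add: power2_eq_square mult_ac)
    finally have "norm (coeff p n + q k) \<le> c * (real K + 1)"
      by (rule power2_le_imp_le) (use c0 in simp)
    then show ?thesis
      using norm_triangle_ineq4[of "coeff p n + q k" "coeff p n"] n by simp
  qed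
  define v where "v n = (if n \<le> K then 0 else (norm (q n))\<^sup>2 / (real n)\<^sup>2)" for n
  have v: "summable v"
    and v_ge: "pi\<^sup>2 / 6 * (real N / (real N + 2 * (\<Sum>k=1..K. norm (q k)))) \<le> suminf v"
    using power_sum_tail_ge[OF w N, where K = K] unfolding v_def[abs_def] q_def by simp_all
  let ?r = "(real K + 1) / (real K + 2)"
  have vs: "?r * v (Suc n) \<le> s n" for n
  proof (cases "Suc n \<le> K")
    case True
    then show ?thesis by (simp add: v_def s0)
  next
    case False
    then have "K \<le> n" by simp
    then have "coeff p n = 0" using K by (intro coeff_eq_0) simp
    have "?r \<le> (real n + 1) / (real n + 2)"
      using \<open>K \<le> n\<close> by (simp add: field_simps)
    then have "?r * ((norm (q (Suc n)))\<^sup>2 / (real n + 1)\<^sup>2)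
        \<le> (real n + 1) / (real n + 2) * ((norm (q (Suc n)))\<^sup>2 / (real n + 1)\<^sup>2)"
      by (rule mult_right_mono) simp
    also have "\<dots> = s n"
      unfolding s_def \<open>coeff p n = 0\<close> by (simp add: power2_eq_square)
    finally show ?thesis using False by (simp add: v_def add.commute)
  qed
  \<comment> \<open>The Taylor coefficient of index n carries the power sum of index n + 1; nothing
    is lost by the shift as \<open>v 0 = 0\<close>.\<close>
  have v_Suc: "suminf v = (\<Sum>n. v (Suc n))"
    using suminf_split_head[OF v] by (simp add: v_def)
  have "?r * suminf v = (\<Sum>n. ?r * v (Suc n))"
    unfolding v_Suc using v by (intro suminf_mult[symmetric]) (simp add: summable_Suc_iff)
  also have "\<dots> \<le> suminf s"
    using v by (intro suminf_le vs s summable_mult) (simp add: summable_Suc_iff)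
  also note sum_le
  finally have "?r * suminf v \<le> c\<^sup>2 / 2" .
  moreover have "?r * (pi\<^sup>2 / 6 * (real N / (real N + 2 * (\<Sum>k=1..K. norm (coeff p (k - 1)) + c * (real K + 1)))))
      \<le> ?r * suminf v"
  proof (rule mult_left_mono)
    define A where "A = (\<Sum>k=1..K. norm (q k))"
    define B where "B = (\<Sum>k=1..K. norm (coeff p (k - 1)) + c * (real K + 1))"
    have "A \<le> B" unfolding A_def B_def by (rule sum_mono[OF q_le])
    moreover have "0 \<le> A" unfolding A_def by (intro sum_nonneg norm_ge_zero)
    ultimately have "real N / (real N + 2 * B) \<le> real N / (real N + 2 * A)"
      using N by (intro divide_left_mono mult_pos_pos) auto
    then have "pi\<^sup>2 / 6 * (real N / (real N + 2 * B)) \<le> pi\<^sup>2 / 6 * (real N / (real N + 2 * A))"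
      by (rule mult_left_mono) simp
    with v_ge show "pi\<^sup>2 / 6 * (real N / (real N + 2 * (\<Sum>k=1..K. norm (coeff p (k - 1)) + c * (real K + 1)))) \<le> suminf v"
      unfolding A_def B_def by (rule order_trans[rotated])
  qed simp
  ultimately have le: "?r * (pi\<^sup>2 / 6 * (real N / (real N + 2 * (\<Sum>k=1..K. norm (coeff p (k - 1)) + c * (real K + 1))))) \<le> c\<^sup>2 / 2"
    by (rule order_trans[rotated])
  have "a * (b / 3) * x \<le> c\<^sup>2" if "a * (b / 6 * x) \<le> c\<^sup>2 / 2" for a b x :: real
    using that by simp
  from this[OF le] show ?thesis .
qed

text \<open>First \<open>K\<close> is fixed so large that (K + 1) / (K + 2) costs less than the gap
  between c^2 and pi^2 / 3. Then \<open>N\<close> grows while the contribution \<open>L\<close> of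
  the low power sums stays constant.\<close>

lemma SF_dist_poly_eventually_ge:
  fixes p :: "complex poly"
  assumes c: "c < pi / sqrt 3"
  shows "\<forall>\<^sub>F N in sequentially. \<forall>h\<in>SF N. c < bergman1_norm (\<lambda>z. poly p z - h z)"
proof (cases "0 \<le> c")
  case False
  then have "c < bergman1_norm g" for g
    using bergman1_norm_nonneg[of g] by linarith
  then show ?thesis by simp
next
  case True
  have "c\<^sup>2 < (pi / sqrt 3)\<^sup>2" using c True by (intro power_strict_mono) auto
  then have c2: "c\<^sup>2 < pi\<^sup>2 / 3" by (simp add: power_divide)
  have "(\<lambda>K. (real K + 1) / (real K + 2) * (pi\<^sup>2 / 3)) \<longlonglongrightarrow> 1 * (pi\<^sup>2 / 3)"
    by (intro tendsto_mult tendsto_const) real_asymp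
  then have "\<forall>\<^sub>F K in sequentially. c\<^sup>2 < (real K + 1) / (real K + 2) * (pi\<^sup>2 / 3)"
    using c2 by (intro order_tendstoD(1)) auto
  then have "\<forall>\<^sub>F K in sequentially. degree p < K \<and> c\<^sup>2 < (real K + 1) / (real K + 2) * (pi\<^sup>2 / 3)"
    by (intro eventually_conj eventually_gt_at_top)
  then obtain K where K: "degree p < K" "c\<^sup>2 < (real K + 1) / (real K + 2) * (pi\<^sup>2 / 3)"
    using eventually_happens'[OF sequentially_bot] by blast
  define L where "L = 2 * (\<Sum>k=1..K. norm (coeff p (k - 1)) + c * (real K + 1))"
  have "(\<lambda>N. real N / (real N + L)) \<longlonglongrightarrow> 1" by real_asymp
  from tendsto_mult[OF tendsto_const this]
  have "(\<lambda>N. (real K + 1) / (real K + 2) * (pi\<^sup>2 / 3) * (real N / (real N + L)))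
      \<longlonglongrightarrow> (real K + 1) / (real K + 2) * (pi\<^sup>2 / 3) * 1" .
  then have "\<forall>\<^sub>F N in sequentially. c\<^sup>2 < (real K + 1) / (real K + 2) * (pi\<^sup>2 / 3) * (real N / (real N + L))"
    using K(2) by (intro order_tendstoD(1)) auto
  then show ?thesis
    using eventually_gt_at_top[of 0]
  proof eventually_elim
    case (elim N)
    show ?case
    proof
      fix h assume "h \<in> SF N"
      then obtain w where h: "h = (\<lambda>z. \<Sum>j<N. 1 / (z - w j))" and w: "\<And>j. j < N \<Longrightarrow> norm (w j) = 1"
        using SF_E by blast
      show "c < bergman1_norm (\<lambda>z. poly p z - h z)"
      proof (rule ccontr)
        assume "\<not> c < bergman1_norm (\<lambda>z. poly p z - h z)"
        then have "bergman1_norm (\<lambda>z. poly p z - (\<Sum>j<N. 1 / (z - w j))) \<le> c" by (simp add: h)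
        from SF_dist_poly_ge[OF w elim(2) K(1) this] elim(1) show False by (simp add: L_def)
      qed
    qed
  qed
qed

lemma SF_nonempty: "SF N \<noteq> {}"
proof -
  have "(\<lambda>z. \<Sum>j<N. 1 / (z - (1 :: complex))) \<in> SF N"
    by (rule SF_I) simp
  then show ?thesis by blast
qed

theorem theorem8:
  fixes f :: "complex \<Rightarrow> complex"
  assumes "f \<in> bergman1"
  shows "(\<lambda>N. bergman1_dist f (SF N)) \<longlonglongrightarrow> pi / sqrt 3"
proof (rule order_tendstoI)
  fix y :: real
  assume y: "pi / sqrt 3 < y"
  \<comment> \<open>One third of the gap pays for replacing f by p, one for the approximation of p,
    and one keeps the inequality strict.\<close>
  define e where "e = (y - pi / sqrt 3) / 3"
  have e: "0 < e" using y by (simp add: e_def)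
  have "a = b + 3 * ((a - b) / 3)" for a b :: real by (simp add: field_simps)
  then have y_eq: "y = pi / sqrt 3 + 3 * e" unfolding e_def .
  obtain p where p: "(\<lambda>z. f z - poly p z) \<in> bergman1" "bergman1_norm (\<lambda>z. f z - poly p z) \<le> e"
    using bergman1_poly_dense[OF assms e] by blast
  obtain N0 where N0: "\<And>N. N \<ge> N0 \<Longrightarrow> \<exists>h\<in>SF N. (\<lambda>z. poly p z - h z) \<in> bergman1 \<and>
      bergman1_norm (\<lambda>z. poly p z - h z) \<le> pi / sqrt 3 + e"
    using SF_approx_poly[OF e] by blast
  show "\<forall>\<^sub>F N in sequentially. bergman1_dist f (SF N) < y"
    using eventually_ge_at_top[of N0]
  proof eventually_elim
    case (elim N)
    obtain h where h: "h \<in> SF N" "(\<lambda>z. poly p z - h z) \<in> bergman1"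
      "bergman1_norm (\<lambda>z. poly p z - h z) \<le> pi / sqrt 3 + e"
      using N0[OF elim] by blast
    have "bergman1_dist f (SF N) \<le> bergman1_norm (\<lambda>z. f z - h z)"
      unfolding bergman1_dist_def by (rule cINF_lower[OF _ h(1)]) (auto intro: bdd_belowI2[of _ 0])
    also have "\<dots> \<le> bergman1_norm (\<lambda>z. f z - poly p z) + bergman1_norm (\<lambda>z. poly p z - h z)"
      using bergman1_triangle(2)[OF p(1) h(2)] by simp
    also have "\<dots> < y" using p(2) h(3) y_eq e by linarith
    finally show ?case .
  qed
next
  fix y :: real
  assume y: "y < pi / sqrt 3"
  define e where "e = (pi / sqrt 3 - y) / 3"
  have e: "0 < e" using y by (simp add: e_def)
  have "a = b - 3 * ((b - a) / 3)" for a b :: real by (simp add: field_simps)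
  then have y_eq: "y = pi / sqrt 3 - 3 * e" unfolding e_def .
  obtain p where p: "(\<lambda>z. f z - poly p z) \<in> bergman1" "bergman1_norm (\<lambda>z. f z - poly p z) \<le> e"
    using bergman1_poly_dense[OF assms e] by blast
  have "\<forall>\<^sub>F N in sequentially. \<forall>h\<in>SF N. pi / sqrt 3 - e < bergman1_norm (\<lambda>z. poly p z - h z)"
    using e by (intro SF_dist_poly_eventually_ge) simp
  then show "\<forall>\<^sub>F N in sequentially. y < bergman1_dist f (SF N)"
  proof eventually_elim
    case (elim N)
    \<comment> \<open>The infimum inherits only a weak inequality; the remaining \<open>e\<close>
      restores strictness.\<close>
    have "pi / sqrt 3 - 2 * e \<le> bergman1_dist f (SF N)"
      unfolding bergman1_dist_def
    proof (rule cINF_greatest[OF SF_nonempty])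
      fix h assume h: "h \<in> SF N"
      have "bergman1_norm (\<lambda>z. poly p z - h z)
          \<le> bergman1_norm (\<lambda>z. f z - h z) + bergman1_norm (\<lambda>z. f z - poly p z)"
        using bergman1_diff(2)[OF bergman1_diff(1)[OF assms SF_bergman1[OF h]] p(1)] by simp
      moreover have "pi / sqrt 3 - e < bergman1_norm (\<lambda>z. poly p z - h z)" using elim h by blast
      ultimately show "pi / sqrt 3 - 2 * e \<le> bergman1_norm (\<lambda>z. f z - h z)"
        using p(2) by linarith
    qed
    moreover have "y < pi / sqrt 3 - 2 * e" using y_eq e by linarith
    ultimately show ?case by linarith
  qed
qed

end
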